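(* For every $n\ge1$, $$\eta(q_1)\,\sigma(y_1)\cdots\sigma(y_n)V(\tau_1,\tau_2,\dots)\big|_{\tau_2=\tau_3=\dots=0}=\mathrm{Coeff}_{x_1^0\cdots x_n^0}\,\mathrm{tr}|_{\mathcal{F}_0}\,\eta(q_1)X(Y[\psi,y_1]\psi^*,x_1)\cdots X(Y[\psi,y_n]\psi^*,x_n)q_1^{\bar L(0)}$$ $$=\mathrm{tr}|_{\mathcal{F}_0}\,\eta(q_1)\,o(Y[\psi,y_1]\psi^* )\cdots o(Y[\psi,y_n]\psi^* )\,q_1^{\bar L(0)},$$ where $\bar L(0)=L(0)-\frac1{24}$.
   Context: Charged free fermions: the Lie superalgebra with odd generators $\psi(n),\psi^*(n)$, $n\in\mathbb{Z}+\frac12$, and central $1$, with $[\psi(n),\psi^*(m)]=\delta_{m+n,0}$, $[\psi(n),\psi(m)]=[\psi^*(n),\psi^*(m)]=0$ (anticommutators). $\mathcal{F}$ is the Fock space generated from $\mathbf 1$ with $\psi(n)\mathbf 1=\psi^*(n)\mathbf 1=0$ for $n>0$, a vertex operator superalgebra of central charge $1$ with conformal vector $\omega=\frac12\psi^*(-3/2)\psi(-1/2)\mathbf 1+\frac12\psi(-3/2)\psi^*(-1/2)\mathbf 1$. Put $\psi=\psi(-1/2)\mathbf 1$, $\psi^*=\psi^*(-1/2)\mathbf 1$. $\mathcal{F}=\bigoplus_{m\in\mathbb{Z}}\mathcal{F}_m$ is the charge decomposition ($\psi(n)$, $\psi^*(n)$ have charges $1,-1$). For homogeneous $u$: $Y(u,x)=\sum_n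 u(n)x^{-n-1}$, $X(u,x)=Y(x^{L(0)}u,x)$, $Y[u,y]=e^{\mathrm{wt}(u)y}Y(u,e^y-1)$ with negative powers of $e^y-1$ expanded in $\mathbb{C}((y))$, $o(a)=a(\mathrm{wt}(a)-1)$ extended linearly (the coefficient of $x^0$ in $X(a,x)$). Thus $X(\psi,x)=\sum_{n\in\mathbb{Z}+1/2}\psi(n)x^{-n}$, $X(\psi^*,x)=\sum_{n\in\mathbb{Z}+1/2}\psi^*(n)x^{-n}$. The normally ordered product is $:X(\psi,e^yx)X(\psi^*,x):\ =\sum_{n<0}\psi(n)(e^yx)^{-n}X(\psi^*,x)-X(\psi^*,x)\sum_{n>0}\psi(n)(e^yx)^{-n}$. For $r\ge0$, $\bar L^{(r)}(0)$ is the coefficient of $x^0\frac{y^r}{r!}$ in $:X(\psi,e^yx)X(\psi^*,x):+\frac{e^{y/2}}{e^y-1}$. Let $q_i=e^{2\pi i\tau_i}$ with $\tau_1$ in the upper half-plane and $q_0$, $\tau_i$ ($i\ge2$) formal. $V(\tau_1,\tau_2,\dots)$ is the coefficient of $q_0^0$ in $\mathrm{tr}|_{\mathcal{F}}\prod_{i\ge0}q_i^{\bar L^{(i)}(0)}$, i.e. $V(\tau_1,\tau_2,\dots)=\mathrm{tr}|_{\mathcal{F}_0}\prod_{i\ge1}q_i^{\bar L^{(i)}(0)}$. For a formal variable $y$, $\sigma(y)=\frac1y+\frac1{2\pi i}\sum_{r\ge1}\frac{y^r}{r!}\frac{\partial}{\partial\tau_r}$. $\eta(q)=q^{1/24}\prod_{n\ge1}(1-q^n)$.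 *)

theory Defs
  imports
    "HOL-Analysis.Analysis"
    "HOL-Computational_Algebra.Formal_Laurent_Series"
    "HOL-Library.Poly_Mapping"
    "HOL-Library.FSet"
begin

section \<open>The fermionic Fock space\<close>

text \<open>
  Half-integers are shifted by one half throughout: the integer \<open>k\<close> stands for the mode number
  \<open>k + 1/2\<close>, so that \<open>k < 0\<close> iff the mode number is negative. The Fock space has the basis
  of monomials \<open>c(k1) c(k2) ... c(kr) \<one>\<close> with \<open>k1 < k2 < ... < kr\<close>, where the creation
  operator \<open>c(k)\<close> is \<open>\<psi>(k + 1/2)\<close> for \<open>k < 0\<close> and \<open>\<psi>*(- k - 1/2)\<close> for \<open>k \<ge> 0\<close>. Such
  a monomial is represented by the finite set \<open>{k1, ..., kr}\<close>.
\<close>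

type_synonym fock = "int fset \<Rightarrow>\<^sub>0 complex"

definition cscale :: "complex \<Rightarrow> fock \<Rightarrow> fock" where
  "cscale c v = Poly_Mapping.map (\<lambda>x. c * x) v"

definition basis_vec :: "int fset \<Rightarrow> fock" where
  "basis_vec S = Poly_Mapping.single S 1"

definition lin_ext :: "(int fset \<Rightarrow> fock) \<Rightarrow> fock \<Rightarrow> fock" where
  "lin_ext f v = (\<Sum>S \<in> Poly_Mapping.keys v. cscale (Poly_Mapping.lookup v S) (f S))"

definition vac :: fock where
  "vac = basis_vec {||}"

text \<open>Sign picked up when moving \<open>c(k)\<close> into its place in an ordered monomial.\<close>

definition place_sign :: "int \<Rightarrow> int fset \<Rightarrow> complex" where
  "place_sign k S = (- 1) ^ card {j. j |\<in>| S \<and> j < k}"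

definition create :: "int \<Rightarrow> fock \<Rightarrow> fock" where
  "create k = lin_ext (\<lambda>S. if k |\<in>| S then 0
     else cscale (place_sign k S) (basis_vec (finsert k S)))"

definition annihilate :: "int \<Rightarrow> fock \<Rightarrow> fock" where
  "annihilate k = lin_ext (\<lambda>S. if k |\<in>| S
     then cscale (place_sign k S) (basis_vec (S |-| {|k|})) else 0)"

text \<open>
  \<open>psi k\<close> is \<open>\<psi>(k + 1/2)\<close> and \<open>psi_star k\<close> is \<open>\<psi>*(k + 1/2)\<close>. These are also the modes of
  index \<open>k\<close> in the expansions \<open>Y(\<psi>,x) = \<Sum>\<^sub>k psi k x\<^bsup>-k-1\<^esup>\<close>
  and \<open>Y(\<psi>*,x) = \<Sum>\<^sub>k psi_star k x\<^bsup>-k-1\<^esup>\<close>.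
\<close>

definition psi :: "int \<Rightarrow> fock \<Rightarrow> fock" where
  "psi k = (if k < 0 then create k else annihilate k)"

definition psi_star :: "int \<Rightarrow> fock \<Rightarrow> fock" where
  "psi_star k = (if k < 0 then create (- k - 1) else annihilate (- k - 1))"

definition psi_vec :: fock where
  "psi_vec = psi (- 1) vac"

definition psi_star_vec :: fock where
  "psi_star_vec = psi_star (- 1) vac"

definition charge :: "int fset \<Rightarrow> int" where
  "charge S = int (card {k. k |\<in>| S \<and> k < 0}) - int (card {k. k |\<in>| S \<and> k \<ge> 0})"

lemma lookup_cscale [simp]: "Poly_Mapping.lookup (cscale c v) S = c * Poly_Mapping.lookup v S"
  unfolding cscale_def by (simp add: Poly_Mapping.map.rep_eq when_def)

lemma lin_ext_superset:
  assumes "finite A" "Poly_Mapping.keys v \<subseteq> A"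
  shows "lin_ext f v = (\<Sum>S\<in>A. cscale (Poly_Mapping.lookup v S) (f S))"
  unfolding lin_ext_def
  by (rule sum.mono_neutral_left[OF assms])
     (auto intro!: poly_mapping_eqI simp: in_keys_iff)

lemma lin_ext_add: "lin_ext f (u + v) = lin_ext f u + lin_ext f v"
proof -
  let ?A = "Poly_Mapping.keys u \<union> Poly_Mapping.keys v"
  have "finite ?A" "Poly_Mapping.keys (u + v) \<subseteq> ?A" by (auto dest: set_mp[OF keys_add])
  then show ?thesis
    by (simp add: lin_ext_superset[of ?A] sum.distrib[symmetric])
       (auto intro!: poly_mapping_eqI sum.cong simp: lookup_sum lookup_add algebra_simps)
qed

lemma lin_ext_cscale: "lin_ext f (cscale c v) = cscale c (lin_ext f v)"
proof -
  have "Poly_Mapping.keys (cscale c v) \<subseteq> Poly_Mapping.keys v" by (auto simp: in_keys_iff)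
  then show ?thesis
    by (simp add: lin_ext_superset[of "Poly_Mapping.keys v"])
       (auto intro!: poly_mapping_eqI simp: lookup_sum sum_distrib_left algebra_simps)
qed

lemma lin_ext_basis_vec [simp]: "lin_ext f (basis_vec S) = f S"
  by (auto intro!: poly_mapping_eqI simp: lin_ext_def basis_vec_def)

lemma lin_ext_zero [simp]: "lin_ext f 0 = 0"
  by (simp add: lin_ext_def)

lemma fock_basis_induct [case_names add cscale basis]:
  assumes "\<And>u v. P u \<Longrightarrow> P v \<Longrightarrow> P (u + v)" "\<And>c v. P v \<Longrightarrow> P (cscale c v)" "\<And>S. P (basis_vec S)"
  shows "P v"
proof -
  have z: "P 0"
    using assms(2)[OF assms(3), of 0] by (metis lookup_cscale lookup_zero mult_zero_left poly_mapping_eqI)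
  have "v = (\<Sum>S\<in>Poly_Mapping.keys v. cscale (Poly_Mapping.lookup v S) (basis_vec S))"
    by (auto intro!: poly_mapping_eqI
        simp: lookup_sum basis_vec_def lookup_single when_def in_keys_iff sum.delta if_distrib cong: if_cong)
  moreover have "P (\<Sum>S\<in>A. cscale (Poly_Mapping.lookup v S) (basis_vec S))" if "finite A" for A
    using that by (induction A) (auto intro: assms z)
  ultimately show ?thesis by (metis finite_keys)
qed

lemma place_sign_finsert:
  "k |\<notin>| S \<Longrightarrow> place_sign j (finsert k S) = (if k < j then - place_sign j S else place_sign j S)"
proof -
  assume k: "k |\<notin>| S"
  have "{i. i |\<in>| finsert k S \<and> i < j} =
    (if k < j then insert k {i. i |\<in>| S \<and> i < j} else {i. i |\<in>| S \<and> i < j})" by auto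
  moreover have "finite {i. i |\<in>| S \<and> i < j}"
    by (rule finite_subset[of _ "fset S"]) auto
  ultimately show ?thesis using k by (simp add: place_sign_def)
qed

lemma create_basis: "create k (basis_vec S) =
    (if k |\<in>| S then 0 else cscale (place_sign k S) (basis_vec (finsert k S)))"
  by (simp add: create_def)

lemma annihilate_basis: "annihilate k (basis_vec S) =
    (if k |\<in>| S then cscale (place_sign k S) (basis_vec (S |-| {|k|})) else 0)"
  by (simp add: annihilate_def)

lemma create_linear:
  "create k (u + v) = create k u + create k v" "create k (cscale c v) = cscale c (create k v)"
  "create k 0 = 0"
  by (simp_all add: create_def lin_ext_add lin_ext_cscale)

lemma annihilate_linear:
  "annihilate k (u + v) = annihilate k u + annihilate k v"
  "annihilate k (cscale c v) = cscale c (annihilate k v)" "annihilate k 0 = 0"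
  by (simp_all add: annihilate_def lin_ext_add lin_ext_cscale)

lemma cscale_algebra:
  "cscale c (u + v) = cscale c u + cscale c v" "cscale c (cscale d v) = cscale (c * d) v"
  "cscale 0 v = 0" "cscale 1 v = v" "cscale c 0 = 0" "cscale (- c) v = - cscale c v"
  "cscale c (- v) = - cscale c v"
  by (auto intro!: poly_mapping_eqI simp: lookup_add algebra_simps)

lemma place_sign_remove:
  assumes "k |\<in>| S"
  shows "place_sign j (S |-| {|k|}) = (if k < j then - place_sign j S else place_sign j S)"
  using place_sign_finsert[of k "S |-| {|k|}" j] assms by (auto simp: finsert_absorb split: if_splits)

lemma place_sign_square [simp]: "place_sign k S * place_sign k S = 1"
  by (simp add: place_sign_def flip: power_add mult_2)

lemma create_create: "create j (create k v) + create k (create j v) = 0"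
proof (induction v rule: fock_basis_induct)
  case (add u v)
  then show ?case by (simp add: create_linear algebra_simps)
next
  case (cscale c v)
  then show ?case by (simp add: create_linear flip: cscale_algebra(1)) (simp add: cscale_algebra)
next
  case (basis S)
  show ?case
    by (cases j k rule: linorder_cases)
       (auto simp: create_basis create_linear cscale_algebra place_sign_finsert finsert_commute mult.commute)
qed

lemma annihilate_annihilate: "annihilate j (annihilate k v) + annihilate k (annihilate j v) = 0"
proof (induction v rule: fock_basis_induct)
  case (add u v)
  then show ?case by (simp add: annihilate_linear algebra_simps)
next
  case (cscale c v)
  then show ?case by (simp add: annihilate_linear flip: cscale_algebra(1)) (simp add: cscale_algebra)
next
  case (basis S)
  have "S |-| {|j|} |-| {|k|} = S |-| {|k|} |-| {|j|}" by auto
  then show ?case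
    by (cases j k rule: linorder_cases)
       (auto simp: annihilate_basis annihilate_linear cscale_algebra place_sign_remove mult.commute)
qed

lemma annihilate_create:
  "annihilate j (create k v) + create k (annihilate j v) = (if j = k then v else 0)"
proof (induction v rule: fock_basis_induct)
  case (add u v)
  have "annihilate j (create k (u + v)) + create k (annihilate j (u + v)) =
    (annihilate j (create k u) + create k (annihilate j u)) +
    (annihilate j (create k v) + create k (annihilate j v))"
    by (simp add: create_linear annihilate_linear algebra_simps)
  then show ?case by (simp add: add)
next
  case (cscale c v)
  then show ?case
    by (simp add: create_linear annihilate_linear flip: cscale_algebra(1)) (simp add: cscale_algebra)
next
  case (basis S)
  have "finsert k S |-| {|j|} = finsert k (S |-| {|j|})" if "j \<noteq> k" using that by auto
  moreover have "finsert k S |-| {|k|} = S" if "k |\<notin>| S" using that by auto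
  ultimately show ?case
    by (cases j k rule: linorder_cases)
       (auto simp: create_basis annihilate_basis create_linear annihilate_linear cscale_algebra
          place_sign_finsert place_sign_remove finsert_absorb mult.commute)
qed

lemma fermion_anticommutators:
  "psi k (psi_star m v) + psi_star m (psi k v) = (if k + m + 1 = 0 then v else 0)"
  "psi k (psi l v) + psi l (psi k v) = 0"
  "psi_star k (psi_star l v) + psi_star l (psi_star k v) = 0"
  using annihilate_create[of k "- m - 1" v] annihilate_create[of "- m - 1" k v]
    annihilate_create[of k l v] annihilate_create[of l k v]
    annihilate_create[of "- k - 1" "- l - 1" v] annihilate_create[of "- l - 1" "- k - 1" v]
  by (auto simp: psi_def psi_star_def create_create annihilate_annihilate add.commute split: if_splits)

lemma vacuum_annihilated: "k \<ge> 0 \<Longrightarrow> psi k vac = 0" "k \<ge> 0 \<Longrightarrow> psi_star k vac = 0"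
  by (simp_all add: psi_def psi_star_def vac_def annihilate_basis)

lemma basis_vec_least:
  assumes "\<And>j. j |\<in>| S \<Longrightarrow> k < j"
  shows "basis_vec (finsert k S) = create k (basis_vec S)"
proof -
  have "{j. j |\<in>| S \<and> j < k} = {}" "k |\<notin>| S" using assms by fastforce+
  then have "place_sign k S = 1" "k |\<notin>| S" by (simp_all only: place_sign_def card.empty power_0 not_False_eq_True)
  then show ?thesis by (simp add: create_basis cscale_algebra)
qed

section \<open>The vertex operator superalgebra structure\<close>

text \<open>
  A field \<open>a(x) = \<Sum>\<^sub>k a k x\<^bsup>-k-1\<^esup>\<close> is given by its modes. For an odd field \<open>a\<close> whose modes
  \<open>a k\<close> are creation operators for \<open>k < 0\<close> and annihilation operators for \<open>k \<ge> 0\<close>, and a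
  field \<open>b\<close> of parity \<open>p\<close>, \<open>normal_product m a p b\<close> is the normally ordered product
  \<open>: (\<partial>\<^sup>m a(x) / m!) b(x) :\<close>. It uses that \<open>\<partial>\<^sup>m a(x) / m!\<close> has the expansion
  \<open>\<Sum>\<^sub>k ((-k-1) gchoose m) a k x\<^bsup>-k-1-m\<^esup>\<close>. On every vector only finitely many summands are
  nonzero, and \<open>Sum_any\<close> is the sum over these.
\<close>

definition normal_product ::
  "nat \<Rightarrow> (int \<Rightarrow> fock \<Rightarrow> fock) \<Rightarrow> nat \<Rightarrow> (int \<Rightarrow> fock \<Rightarrow> fock) \<Rightarrow> int \<Rightarrow> fock \<Rightarrow> fock" where
  "normal_product m a p b n v =
     Sum_any (\<lambda>k::int. cscale (of_int (- k - 1) gchoose m)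
       (if k < 0 then a k (b (n - k - int m - 1) v)
        else cscale ((- 1) ^ p) (b (n - k - int m - 1) (a k v))))"

text \<open>
  Modes of \<open>Y(c(k1) ... c(kr) \<one>, x)\<close>, from \<open>Y(a(-m-1) u, x) = : (\<partial>\<^sup>m Y(a,x) / m!) Y(u,x) :\<close>
  for \<open>a = \<psi>, \<psi>*\<close>, where \<open>a(-m-1)\<close> is the mode of \<open>Y(a,x)\<close> at \<open>x\<^sup>m\<close>.
\<close>

primrec monomial_op :: "int list \<Rightarrow> int \<Rightarrow> fock \<Rightarrow> fock" where
  "monomial_op [] n v = (if n = - 1 then v else 0)"
| "monomial_op (k # ks) n v =
     (if k < 0 then normal_product (nat (- k - 1)) psi (length ks) (monomial_op ks) n v
      else normal_product (nat k) psi_star (length ks) (monomial_op ks) n v)"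

text \<open>\<open>Y_mode u n\<close> is \<open>u(n)\<close>, the coefficient of \<open>x\<^bsup>-n-1\<^esup>\<close> in \<open>Y(u,x)\<close>.\<close>

definition Y_mode :: "fock \<Rightarrow> int \<Rightarrow> fock \<Rightarrow> fock" where
  "Y_mode u n v = lin_ext (\<lambda>S. monomial_op (sorted_list_of_fset S) n v) u"

lemma psi_vec_basis: "psi_vec = basis_vec {|- 1|}" "psi_star_vec = basis_vec {|0|}"
  using basis_vec_least[of "{||}" "- 1"] basis_vec_least[of "{||}" 0]
  by (simp_all add: psi_vec_def psi_star_vec_def psi_def psi_star_def vac_def)

lemma Y_mode_generators: "Y_mode psi_vec n = psi n" "Y_mode psi_star_vec n = psi_star n"
proof -
  have l: "sorted_list_of_fset {|k|} = [k]" for k :: int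
    by (simp add: sorted_list_of_fset.rep_eq)
  have z: "psi k 0 = 0" "psi_star k 0 = 0" for k
    by (simp_all add: psi_def psi_star_def create_linear annihilate_linear)
  have "normal_product 0 a 0 (monomial_op []) n v = a n v" if "\<And>k. a k 0 = 0" for a v
  proof -
    have "normal_product 0 a 0 (monomial_op []) n v = Sum_any (\<lambda>k. a k v when k = n)"
      unfolding normal_product_def using that
      by (intro arg_cong[where f = Sum_any] ext) (auto simp: cscale_algebra when_def)
    then show ?thesis by simp
  qed
  then show "Y_mode psi_vec n = psi n" "Y_mode psi_star_vec n = psi_star n"
    using z by (auto simp: fun_eq_iff Y_mode_def psi_vec_basis l)
qed

definition omega :: fock where
  "omega = cscale (1/2) (psi_star (- 2) (psi (- 1) vac)) + cscale (1/2) (psi (- 2) (psi_star (- 1) vac))"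

definition L0 :: "fock \<Rightarrow> fock" where
  "L0 = Y_mode omega 1"

definition L0_bar :: "fock \<Rightarrow> fock" where
  "L0_bar v = L0 v - cscale (1/24) v"

text \<open>Only meaningful for nonzero homogeneous vectors, such as the basis vectors.\<close>

definition wt :: "fock \<Rightarrow> rat" where
  "wt u = (THE w. L0 u = cscale (of_rat w) u)"

text \<open>
  The constructions below are defined on homogeneous vectors and extended linearly, using the
  homogeneous basis. \<open>X_coeff u e\<close> is the coefficient of \<open>x\<^sup>e\<close> in \<open>X(u,x)\<close>; for homogeneous \<open>u\<close>
  this is \<open>u(n)\<close> if \<open>e = wt u - n - 1\<close> with \<open>n\<close> an integer. The exponent may be a proper half-integer.
\<close>

definition Y_mode_rat :: "fock \<Rightarrow> rat \<Rightarrow> fock \<Rightarrow> fock" where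
  "Y_mode_rat u r v = (if r \<in> \<int> then Y_mode u \<lfloor>r\<rfloor> v else 0)"

definition X_coeff :: "fock \<Rightarrow> rat \<Rightarrow> fock \<Rightarrow> fock" where
  "X_coeff u e v = lin_ext (\<lambda>S. Y_mode_rat (basis_vec S) (wt (basis_vec S) - e - 1) v) u"

definition o_mode :: "fock \<Rightarrow> fock \<Rightarrow> fock" where
  "o_mode a v = lin_ext (\<lambda>S. Y_mode_rat (basis_vec S) (wt (basis_vec S) - 1) v) a"

text \<open>
  \<open>Y_bracket_coeff u v k\<close> is the coefficient of \<open>y\<^sup>k\<close> in
  \<open>Y[u,y]v = \<Sum>\<^sub>n e\<^bsup>wt(u) y\<^esup> (e\<^sup>y - 1)\<^bsup>-n-1\<^esup> u(n)v\<close>.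
\<close>

definition exp_minus_one :: "complex fls" where
  "exp_minus_one = fps_to_fls (fps_exp 1 - 1)"

definition Y_bracket_coeff :: "fock \<Rightarrow> fock \<Rightarrow> int \<Rightarrow> fock" where
  "Y_bracket_coeff u v k = lin_ext (\<lambda>S. Sum_any (\<lambda>n::int.
     cscale (fls_nth (fps_to_fls (fps_exp (of_rat (wt (basis_vec S)))) * exp_minus_one powi (- n - 1)) k)
       (Y_mode (basis_vec S) n v))) u"


section \<open>Zero modes, powers of q and traces\<close>

text \<open>
  \<open>normal_pair_coeff s r\<close> is the coefficient of \<open>x\<^sup>s y\<^sup>r / r!\<close> in \<open>: X(\<psi>, e\<^sup>y x) X(\<psi>*, x) :\<close>.
  With \<open>n = k + 1/2\<close> and \<open>m = - s - n\<close>, the pair \<open>\<psi>(n)\<close>, \<open>\<psi>*(m)\<close> contributes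
  \<open>e\<^bsup>-ny\<^esup> x\<^bsup>-n-m\<^esup>\<close>, and \<open>m = (- s - k - 1) + 1/2\<close>.
\<close>

definition normal_pair_coeff :: "int \<Rightarrow> nat \<Rightarrow> fock \<Rightarrow> fock" where
  "normal_pair_coeff s r v =
     Sum_any (\<lambda>k::int. cscale (fact r * fps_nth (fps_exp (- (of_int k + 1/2))) r)
       (if k < 0 then psi k (psi_star (- s - k - 1) v)
        else - psi_star (- s - k - 1) (psi k v)))"

text \<open>The coefficient of \<open>x\<^sup>0 y\<^sup>r / r!\<close> in \<open>: X(\<psi>, e\<^sup>y x) X(\<psi>*, x) : + e\<^bsup>y/2\<^esup> / (e\<^sup>y - 1)\<close>.\<close>

definition L_bar :: "nat \<Rightarrow> fock \<Rightarrow> fock" where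
  "L_bar r v = normal_pair_coeff 0 r v
     + cscale (fact r * fls_nth (fps_to_fls (fps_exp (1/2)) / exp_minus_one) (int r)) v"

text \<open>
  The operator \<open>q\<^sup>A = exp(2 \<pi> i \<tau> A)\<close> for a complex number \<open>\<tau>\<close>, as an exponential series that
  converges entrywise. For an operator \<open>A\<close> that is diagonal in the chosen basis, such as \<open>L(0)\<close>,
  it multiplies each eigenvector by \<open>exp(2 \<pi> i \<tau> \<lambda>)\<close>, where \<open>\<lambda>\<close> is the eigenvalue.
\<close>

definition q_power :: "complex \<Rightarrow> (fock \<Rightarrow> fock) \<Rightarrow> fock \<Rightarrow> fock" where
  "q_power \<tau> A v = Abs_poly_mapping (\<lambda>S.
     suminf (\<lambda>j. (2 * of_real pi * \<i> * \<tau>) ^ j / fact j * Poly_Mapping.lookup ((A ^^ j) v) S))"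

text \<open>For a formal variable \<open>\<tau>\<close>, the coefficient of \<open>\<tau>\<^sup>j\<close> in \<open>q\<^sup>A = exp(2 \<pi> i \<tau> A)\<close>.\<close>

definition q_power_coeff :: "nat \<Rightarrow> (fock \<Rightarrow> fock) \<Rightarrow> fock \<Rightarrow> fock" where
  "q_power_coeff j A v = cscale ((2 * of_real pi * \<i>) ^ j / fact j) ((A ^^ j) v)"

text \<open>The trace over the charge zero subspace.\<close>

definition trace_F0 :: "(fock \<Rightarrow> fock) \<Rightarrow> complex" where
  "trace_F0 B = infsum (\<lambda>S. Poly_Mapping.lookup (B (basis_vec S)) S) {S. charge S = 0}"


section \<open>The function \<open>V\<close> and the operator \<open>\<sigma>\<close>\<close>

text \<open>
  Formal power series in \<open>\<tau>\<^sub>2, \<tau>\<^sub>3, ...\<close> whose coefficients are functions of \<open>\<tau>\<^sub>1\<close>: a finitely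
  supported exponent vector \<open>\<alpha>\<close> is mapped to the coefficient of \<open>\<Prod>\<^sub>i \<tau>\<^sub>i\<^bsup>\<alpha>(i)\<^esup>\<close>. The
  exponents \<open>\<alpha>(0)\<close> and \<open>\<alpha>(1)\<close> do not occur.
\<close>

type_synonym tau_series = "(nat \<Rightarrow>\<^sub>0 nat) \<Rightarrow> complex \<Rightarrow> complex"

definition V :: tau_series where
  "V \<alpha> \<tau> = (if Poly_Mapping.keys \<alpha> \<subseteq> {2..} then
     trace_F0 (\<lambda>v. foldr (\<lambda>i. q_power_coeff (Poly_Mapping.lookup \<alpha> i) (L_bar i)) (sorted_list_of_set (Poly_Mapping.keys \<alpha>))
       (q_power \<tau> (L_bar 1) v)) else 0)"

text \<open>The partial derivative with respect to \<open>\<tau>\<^sub>r\<close>, for \<open>r \<ge> 1\<close>.\<close>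

definition d_tau :: "nat \<Rightarrow> tau_series \<Rightarrow> tau_series" where
  "d_tau r f = (if r = 1 then (\<lambda>\<alpha> \<tau>. deriv (f \<alpha>) \<tau>)
     else (\<lambda>\<alpha> \<tau>. of_nat (Poly_Mapping.lookup \<alpha> r + 1) * f (\<alpha> + Poly_Mapping.single r 1) \<tau>))"

text \<open>
  \<open>sigma_coeff k\<close> is the coefficient of \<open>y\<^sup>k\<close> in \<open>\<sigma>(y)\<close>. Hence \<open>foldr sigma_coeff [k1, ..., kn] f\<close>
  is the coefficient of \<open>y\<^sub>1\<^bsup>k1\<^esup> ... y\<^sub>n\<^bsup>kn\<^esup>\<close> in \<open>\<sigma>(y\<^sub>1) ... \<sigma>(y\<^sub>n) f\<close>.
\<close>

definition sigma_coeff :: "int \<Rightarrow> tau_series \<Rightarrow> tau_series" where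
  "sigma_coeff k f =
     (if k = - 1 then f
      else if k \<ge> 1 then (\<lambda>\<alpha> \<tau>. 1 / (2 * of_real pi * \<i>) * (1 / fact (nat k)) * d_tau (nat k) f \<alpha> \<tau>)
      else (\<lambda>\<alpha> \<tau>. 0))"

definition at_zero :: "tau_series \<Rightarrow> complex \<Rightarrow> complex" where
  "at_zero f \<tau> = f 0 \<tau>"

text \<open>\<open>\<eta>(q)\<close> for \<open>q = exp(2 \<pi> i \<tau>)\<close>, with \<open>q\<^bsup>1/24\<^esup> = exp(2 \<pi> i \<tau> / 24)\<close>.\<close>

definition eta :: "complex \<Rightarrow> complex" where
  "eta \<tau> = exp (2 * of_real pi * \<i> * \<tau> / 24)
     * prodinf (\<lambda>n. 1 - exp (2 * of_real pi * \<i> * \<tau>) ^ Suc n)"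

text \<open>
  The coefficient of \<open>x\<^sub>1\<^bsup>e1\<^esup> ... x\<^sub>n\<^bsup>en\<^esup> y\<^sub>1\<^bsup>k1\<^esup> ... y\<^sub>n\<^bsup>kn\<^esup>\<close> in
  \<open>tr \<eta>(q\<^sub>1) X(Y[\<psi>,y\<^sub>1]\<psi>*, x\<^sub>1) ... X(Y[\<psi>,y\<^sub>n]\<psi>*, x\<^sub>n) q\<^sub>1\<^bsup>L(0) - 1/24\<^esup>\<close> over the charge zero
  subspace, for \<open>es = [e1, ..., en]\<close> and \<open>ks = [k1, ..., kn]\<close>.
\<close>

definition X_trace_coeff :: "rat list \<Rightarrow> int list \<Rightarrow> complex \<Rightarrow> complex" where
  "X_trace_coeff es ks \<tau> = trace_F0 (\<lambda>v. cscale (eta \<tau>)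
     (foldr (\<lambda>(e, k). X_coeff (Y_bracket_coeff psi_vec psi_star_vec k) e) (zip es ks)
       (q_power \<tau> L0_bar v)))"

text \<open>
  The coefficient of \<open>y\<^sub>1\<^bsup>k1\<^esup> ... y\<^sub>n\<^bsup>kn\<^esup>\<close> in
  \<open>tr \<eta>(q\<^sub>1) o(Y[\<psi>,y\<^sub>1]\<psi>*) ... o(Y[\<psi>,y\<^sub>n]\<psi>*) q\<^sub>1\<^bsup>L(0) - 1/24\<^esup>\<close>.
\<close>

definition o_trace_coeff :: "int list \<Rightarrow> complex \<Rightarrow> complex" where
  "o_trace_coeff ks \<tau> = trace_F0 (\<lambda>v. cscale (eta \<tau>)
     (foldr (\<lambda>k. o_mode (Y_bracket_coeff psi_vec psi_star_vec k)) ks (q_power \<tau> L0_bar v)))"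

end

theory Submission
  imports Defs "HOL-Complex_Analysis.Cauchy_Integral_Formula"
begin

text \<open>
  All operators in the statement are simultaneously diagonal in the basis of fermion monomials
  (\<open>diagonal_op\<close>): the charge zero, weight zero part of a normally ordered pair only counts
  occupied states. Hence all three traces are sums over the finite sets \<open>S\<close> of charge zero, and
  the identities reduce to identities between eigenvalues.

  The link is \<open>o(Y[\<psi>,y]\<psi>*) = \<Sum>\<^sub>r y\<^sup>r/r! L(r) + 1/y\<close>, where \<open>L(r)\<close> is the zero mode
  defining \<open>V\<close>. The bracket operator expands into the vectors \<open>\<psi>(-j-1/2)\<psi>*(-1/2)\<one>\<close> with
  coefficients \<open>e\<^bsup>y/2\<^esup>(e\<^sup>y-1)\<^sup>j\<close>. At the state \<open>k\<close>, whose mode number is \<open>k + 1/2\<close>, the zero mode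
  of the \<open>j\<close>-th vector has the eigenvalue \<open>(-k-1) choose j\<close>, up to the sign of the charge.
  Newton's binomial series sums these to \<open>e\<^bsup>y/2\<^esup> e\<^bsup>(-k-1)y\<^esup> = e\<^bsup>-(k+1/2)y\<^esup>\<close>, the generating function
  of the eigenvalues of the normally ordered pairs (\<open>sum_gbinomial_exp\<close>,
  \<open>diagonal_op_o_mode\<close>, \<open>diagonal_op_L_bar\<close>). The vacuum term is \<open>e\<^bsup>y/2\<^esup>/(e\<^sup>y-1)\<close>, whose
  expansion \<open>1/y - y/24 + ...\<close> supplies the \<open>1/y\<close> of \<open>\<sigma>(y)\<close> and the shift in \<open>L(0) - 1/24\<close>.
  The coefficient at \<open>y\<^sup>0\<close> is the charge, which is zero on the space over which the trace is
  taken; this matches the missing \<open>\<partial>/\<partial>\<tau>\<^sub>0\<close> in \<open>\<sigma>\<close>.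

  On the other side, \<open>(1/2\<pi>i) \<partial>/\<partial>\<tau>\<^sub>r\<close> multiplies each term of the trace by the
  eigenvalue of \<open>L(r)\<close>. For the formal variables this is a computation with coefficients
  (\<open>formal_eigenvalue_single\<close>). For \<open>\<tau>\<^sub>1\<close> the sum has to be differentiated termwise
  (\<open>deriv_trace\<close>). This holds because the eigenvalues grow polynomially in the energy
  \<open>L(0)\<close>, while \<open>\<Sum>\<^sub>S e\<^bsup>-t L(0)\<^esup> = \<Prod>\<^sub>k (1 + e\<^bsup>-t |k+1/2|\<^esup>)\<close> converges for every \<open>t > 0\<close>.
  Induction on the number of factors \<open>\<sigma>\<close> then gives \<open>foldr_sigma_coeff_V\<close>.
\<close>

section \<open>Operators that are diagonal in the monomial basis\<close>

text \<open>
  Scaled basis vectors are built into the definition so that diagonal operators compose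
  without a proof that they are linear.
\<close>

definition diagonal_op :: "(fock \<Rightarrow> fock) \<Rightarrow> (int fset \<Rightarrow> complex) \<Rightarrow> bool" where
  "diagonal_op A a \<longleftrightarrow> (\<forall>c S. A (cscale c (basis_vec S)) = cscale (a S * c) (basis_vec S))"

lemma diagonal_opD: "diagonal_op A a \<Longrightarrow> A (cscale c (basis_vec S)) = cscale (a S * c) (basis_vec S)"
  by (simp add: diagonal_op_def)

lemma diagonal_op_basis: "diagonal_op A a \<Longrightarrow> A (basis_vec S) = cscale (a S) (basis_vec S)"
  using diagonal_opD[of A a 1 S] by (simp add: cscale_algebra)

lemma lookup_basis_vec: "Poly_Mapping.lookup (basis_vec S) T = (if S = T then 1 else 0)"
  by (simp add: basis_vec_def lookup_single when_def)

lemma diagonal_op_cscale: "diagonal_op A a \<Longrightarrow> diagonal_op (\<lambda>v. cscale c (A v)) (\<lambda>S. c * a S)"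
  by (simp add: diagonal_op_def cscale_algebra mult.assoc)

lemma cscale_add_left: "cscale (c + d) v = cscale c v + cscale d v"
  by (auto intro!: poly_mapping_eqI simp: lookup_add algebra_simps)

lemma cscale_diff_left: "cscale (c - d) v = cscale c v - cscale d v"
  by (intro poly_mapping_eqI) (simp add: lookup_minus left_diff_distrib)

lemma cscale_sum_left: "cscale (\<Sum>i\<in>A. f i) v = (\<Sum>i\<in>A. cscale (f i) v)"
  by (auto intro!: poly_mapping_eqI simp: lookup_sum sum_distrib_right)

lemma diagonal_op_foldr:
  assumes "\<And>k. k \<in> set ks \<Longrightarrow> diagonal_op (A k) (a k)" and "diagonal_op B b"
  shows "diagonal_op (\<lambda>v. foldr A ks (B v)) (\<lambda>S. (\<Prod>k\<leftarrow>ks. a k S) * b S)"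
  using assms
proof (induction ks)
  case (Cons k ks)
  then show ?case by (simp add: diagonal_op_def mult.assoc)
qed simp

lemma diagonal_op_funpow:
  assumes "diagonal_op A a"
  shows "(A ^^ j) (cscale c (basis_vec S)) = cscale (a S ^ j * c) (basis_vec S)"
  by (induction j) (simp_all add: diagonal_opD[OF assms] mult.assoc)

lemma diagonal_op_q_power:
  assumes "diagonal_op A a"
  shows "diagonal_op (q_power \<tau> A) (\<lambda>S. exp (2 * of_real pi * \<i> * \<tau> * a S))"
  unfolding diagonal_op_def
proof (intro allI)
  fix c S
  have "suminf (\<lambda>j. (2 * of_real pi * \<i> * \<tau>) ^ j / fact j *
          Poly_Mapping.lookup ((A ^^ j) (cscale c (basis_vec S))) T) =
        Poly_Mapping.lookup (cscale (exp (2 * of_real pi * \<i> * \<tau> * a S) * c) (basis_vec S)) T" for T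
  proof -
    let ?x = "2 * of_real pi * \<i> * \<tau> * a S" and ?d = "c * (if S = T then 1 else 0 :: complex)"
    have "(\<lambda>j. (?x ^ j /\<^sub>R fact j) * ?d) sums (exp ?x * ?d)"
      by (rule sums_mult2[OF exp_converges])
    moreover have "(\<lambda>j. (2 * of_real pi * \<i> * \<tau>) ^ j / fact j *
          Poly_Mapping.lookup ((A ^^ j) (cscale c (basis_vec S))) T) = (\<lambda>j. (?x ^ j /\<^sub>R fact j) * ?d)"
      by (auto simp: fun_eq_iff diagonal_op_funpow[OF assms] lookup_basis_vec scaleR_conv_of_real
          field_simps power_mult_distrib)
    ultimately show ?thesis
      by (simp add: sums_iff lookup_basis_vec)
  qed
  then show "q_power \<tau> A (cscale c (basis_vec S)) =
      cscale (exp (2 * of_real pi * \<i> * \<tau> * a S) * c) (basis_vec S)"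
    by (simp add: q_power_def lookup_inverse del: lookup_cscale)
qed

lemma diagonal_op_q_power_coeff:
  assumes "diagonal_op A a"
  shows "diagonal_op (q_power_coeff j A) (\<lambda>S. (2 * of_real pi * \<i> * a S) ^ j / fact j)"
  by (simp add: diagonal_op_def q_power_coeff_def diagonal_op_funpow[OF assms] cscale_algebra
      power_mult_distrib mult.assoc)

lemma trace_F0_diagonal:
  assumes "diagonal_op B b"
  shows "trace_F0 B = (\<Sum>\<^sub>\<infinity>S\<in>{S. charge S = 0}. b S)"
  by (simp add: trace_F0_def diagonal_op_basis[OF assms] lookup_basis_vec)


section \<open>Zero modes of normally ordered pairs\<close>

text \<open>
  The general normally ordered quadratic expression of charge zero and weight zero. The zero
  modes in both traces and \<open>L(0)\<close> are all of this form, up to an additive constant.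
\<close>

definition pair_sum :: "(int \<Rightarrow> complex) \<Rightarrow> fock \<Rightarrow> fock" where
  "pair_sum g v = Sum_any (\<lambda>k::int. cscale (g k)
     (if k < 0 then psi k (psi_star (- k - 1) v) else - psi_star (- k - 1) (psi k v)))"

definition signed_sum :: "(int \<Rightarrow> complex) \<Rightarrow> int fset \<Rightarrow> complex" where
  "signed_sum g S = (\<Sum>k\<in>fset S. (if k < 0 then 1 else - 1) * g k)"

lemma create_annihilate_basis:
  "create k (annihilate k (basis_vec S)) = (if k |\<in>| S then basis_vec S else 0)"
  by (auto simp: annihilate_basis create_linear create_basis cscale_algebra place_sign_remove finsert_absorb)

text \<open>
  Normal ordering turns each pair into the number operator of the state \<open>k\<close>, with the sign of
  the charge which that state carries.
\<close>

lemma diagonal_op_pair_sum: "diagonal_op (pair_sum g) (signed_sum g)"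
  unfolding diagonal_op_def
proof (intro allI)
  fix c S
  let ?t = "\<lambda>k. if k |\<in>| S then cscale ((if k < 0 then 1 else - 1) * g k * c) (basis_vec S) else 0"
  have "pair_sum g (cscale c (basis_vec S)) = Sum_any ?t"
    unfolding pair_sum_def
    by (intro arg_cong[where f = Sum_any] ext)
       (simp add: psi_def psi_star_def create_linear annihilate_linear create_annihilate_basis cscale_algebra)
  also have "\<dots> = sum ?t (fset S)"
    by (rule Sum_any.expand_superset) auto
  also have "\<dots> = cscale (signed_sum g S * c) (basis_vec S)"
    by (simp add: signed_sum_def sum_distrib_right cscale_sum_left)
  finally show "pair_sum g (cscale c (basis_vec S)) = cscale (signed_sum g S * c) (basis_vec S)" .
qed

lemma psi_cscale: "psi k (cscale c v) = cscale c (psi k v)"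
    "psi_star k (cscale c v) = cscale c (psi_star k v)"
  by (simp_all add: psi_def psi_star_def create_linear annihilate_linear)

lemma psi_zero: "psi k 0 = 0" "psi_star k 0 = 0"
  by (simp_all add: psi_def psi_star_def create_linear annihilate_linear)

lemma monomial_op_psi_star:
  assumes "b \<ge> 0"
  shows "monomial_op [b] n v = cscale (of_int (b - n - 1) gchoose nat b) (psi_star (n - b) v)"
proof -
  have "monomial_op [b] n v =
      Sum_any (\<lambda>k. cscale (of_int (- k - 1) gchoose nat b) (psi_star k v) when k = n - b)"
    using assms unfolding monomial_op.simps normal_product_def if_not_P[OF leD[OF assms]]
    by (intro arg_cong[where f = Sum_any] ext) (auto simp: cscale_algebra when_def psi_zero)
  also have "\<dots> = cscale (of_int (b - n - 1) gchoose nat b) (psi_star (n - b) v)"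
    by simp
  finally show ?thesis .
qed

text \<open>
  Here \<open>b - a - 1\<close> is the conformal weight of the pair minus one, the index of the zero mode.
  The binomial coefficients come from the divided derivatives in the two factors.
\<close>

lemma Y_mode_pair:
  assumes "a < 0" "b \<ge> 0"
  shows "Y_mode (basis_vec {|a, b|}) (b - a - 1) =
    pair_sum (\<lambda>k. (of_int (- k - 1) gchoose nat (- a - 1)) * (of_int k gchoose nat b))"
proof
  fix v
  have "sorted_list_of_fset {|a, b|} = [a, b]"
    using assms by (simp add: sorted_list_of_fset.rep_eq)
  then have "Y_mode (basis_vec {|a, b|}) (b - a - 1) v =
      normal_product (nat (- a - 1)) psi 1 (monomial_op [b]) (b - a - 1) v"
    using assms by (simp add: Y_mode_def del: monomial_op.simps(1))
  also have "\<dots> = pair_sum (\<lambda>k. (of_int (- k - 1) gchoose nat (- a - 1)) * (of_int k gchoose nat b)) v"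
    unfolding normal_product_def pair_sum_def monomial_op_psi_star[OF assms(2)]
    using assms by (intro arg_cong[where f = Sum_any] ext) (simp add: psi_cscale cscale_algebra)
  finally show "Y_mode (basis_vec {|a, b|}) (b - a - 1) v =
    pair_sum (\<lambda>k. (of_int (- k - 1) gchoose nat (- a - 1)) * (of_int k gchoose nat b)) v" .
qed

lemma Y_mode_vac: "Y_mode vac (- 1) v = v"
  by (simp add: Y_mode_def vac_def sorted_list_of_fset.rep_eq)


section \<open>Conformal weights\<close>

definition energy :: "int fset \<Rightarrow> real" where
  "energy S = (\<Sum>k\<in>fset S. \<bar>of_int k + 1/2\<bar>)"

lemma energy_signed_sum: "complex_of_real (energy S) = signed_sum (\<lambda>k. - (of_int k + 1/2)) S"
  unfolding energy_def signed_sum_def of_real_sum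
proof (intro sum.cong refl)
  fix k :: int
  have "\<bar>of_int k + 1/2\<bar> = (if k < 0 then - (of_int k + 1/2) else of_int k + 1/2 :: real)"
    by (auto simp: abs_if)
  then show "complex_of_real \<bar>of_int k + 1/2\<bar> = (if k < 0 then 1 else - 1) * - (of_int k + 1/2)"
    by simp
qed

lemma omega_basis:
  "omega = cscale (- 1/2) (basis_vec {|- 1, 1|}) + cscale (1/2) (basis_vec {|- 2, 0|})"
proof -
  have "create 1 (create (- 1) vac) = - basis_vec {|- 1, 1|}"
    by (simp add: vac_def create_basis create_linear cscale_algebra place_sign_finsert finsert_commute)
       (simp add: place_sign_def cscale_algebra)
  moreover have "create (- 2) (create 0 vac) = basis_vec {|- 2, 0|}"
    by (simp add: vac_def create_basis create_linear cscale_algebra place_sign_finsert)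
       (simp add: place_sign_def cscale_algebra)
  ultimately show ?thesis
    by (simp add: omega_def psi_def psi_star_def cscale_algebra)
qed

text \<open>
  The two summands of \<open>\<omega>\<close> contribute \<open>-k/2\<close> and \<open>(-k-1)/2\<close> to the coefficient of the pair
  \<open>k\<close>. Their sum \<open>-(k + 1/2)\<close> has the sign of the charge of that state, so that an occupied
  state \<open>k\<close> adds \<open>\<bar>k + 1/2\<bar>\<close> to the eigenvalue of \<open>L(0)\<close>.
\<close>

lemma diagonal_op_L0: "diagonal_op L0 (\<lambda>S. complex_of_real (energy S))"
  unfolding diagonal_op_def
proof (intro allI)
  fix c S
  let ?g = "\<lambda>k::int. complex_of_int k" and ?h = "\<lambda>k::int. complex_of_int (- k - 1)"
  have "Y_mode (basis_vec {|- 1, 1|}) 1 = pair_sum ?g"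
    using Y_mode_pair[of "- 1" 1] by simp
  moreover have "Y_mode (basis_vec {|- 2, 0|}) 1 = pair_sum ?h"
    using Y_mode_pair[of "- 2" 0] by simp
  moreover have "L0 v = cscale (- 1/2) (Y_mode (basis_vec {|- 1, 1|}) 1 v)
      + cscale (1/2) (Y_mode (basis_vec {|- 2, 0|}) 1 v)" for v
    by (simp only: L0_def Y_mode_def omega_basis lin_ext_add lin_ext_cscale lin_ext_basis_vec)
  ultimately have "L0 (cscale c (basis_vec S)) =
      cscale (- 1/2 * signed_sum ?g S * c + 1/2 * signed_sum ?h S * c) (basis_vec S)"
    by (simp add: diagonal_opD[OF diagonal_op_pair_sum] cscale_algebra cscale_diff_left mult.assoc
        del: of_int_diff of_int_minus)
  moreover have "- 1/2 * signed_sum ?g S + 1/2 * signed_sum ?h S = energy S"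
    unfolding energy_signed_sum signed_sum_def sum_distrib_left sum.distrib[symmetric]
    by (intro sum.cong refl) (simp add: field_simps)
  ultimately show "L0 (cscale c (basis_vec S)) = cscale (energy S * c) (basis_vec S)"
    by (metis distrib_right)
qed

lemma cscale_basis_inj: "cscale c (basis_vec S) = cscale d (basis_vec S) \<longleftrightarrow> c = d"
  by (metis lookup_basis_vec lookup_cscale mult.right_neutral)

lemma wt_basis_vec:
  assumes "complex_of_real (energy S) = of_rat w"
  shows "wt (basis_vec S) = w"
  by (simp add: wt_def diagonal_op_basis[OF diagonal_op_L0] cscale_basis_inj assms)

lemma wt_psi: "wt psi_vec = 1/2"
  unfolding psi_vec_basis by (rule wt_basis_vec) (simp add: energy_def of_rat_divide)

lemma wt_vac: "wt vac = 0"
  unfolding vac_def by (rule wt_basis_vec) (simp add: energy_def)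

lemma wt_pair:
  assumes "a < 0"
  shows "wt (basis_vec {|a, 0|}) = of_int (- a)"
proof -
  have "real_of_int a \<le> - 1" using assms by linarith
  then have "energy {|a, 0|} = of_int (- a)"
    using assms by (auto simp: energy_def abs_if)
  then show ?thesis
    by (intro wt_basis_vec) (simp add: of_rat_minus)
qed


section \<open>The bracket vertex operator\<close>

text \<open>
  This is \<open>1 / (2 sinh(y/2))\<close>. It is the coefficient of the vacuum in \<open>Y[\<psi>,y]\<psi>*\<close>, and also
  the generating function of the constants in the \<open>L_bar\<close>.
\<close>

definition pole_kernel :: "complex fls" where
  "pole_kernel = fps_to_fls (fps_exp (1/2)) / exp_minus_one"

text \<open>
  Dividing \<open>e\<^sup>y - 1 = y e(y)\<close> by \<open>y\<close> leaves an invertible power series \<open>e\<close>. The coefficients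
  follow from comparing the lowest three coefficients in \<open>h e = e\<^bsup>y/2\<^esup>\<close>.
\<close>

lemma pole_kernel_nth:
  shows "K < - 1 \<Longrightarrow> fls_nth pole_kernel K = 0"
    and "fls_nth pole_kernel (- 1) = 1"
    and "fls_nth pole_kernel 0 = 0"
    and "fls_nth pole_kernel 1 = - 1/24"
proof -
  define e h :: "complex fps" where "e = fps_shift 1 (fps_exp 1 - 1)" and "h = fps_exp (1/2) / e"
  have e0: "fps_nth e 0 = 1" and e: "fps_nth e 1 = 1/2" "fps_nth e 2 = 1/6"
    by (simp_all add: e_def fact_numeral)
  have he: "h * e = fps_exp (1/2)"
    using e0 by (simp add: h_def)
  have "fps_exp 1 - 1 = fps_X * e"
    by (rule fps_ext) (simp add: e_def fps_X_mult_nth)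
  then have x: "exp_minus_one = fls_X * fps_to_fls e"
    by (simp add: exp_minus_one_def fls_times_fps_to_fls)
  have "e \<noteq> 0" using e0 by auto
  then have nz: "exp_minus_one \<noteq> 0" by (simp add: x)
  have "fls_shift 1 (fps_to_fls h) * exp_minus_one = fps_to_fls (h * e)"
    by (simp add: x fls_times_fps_to_fls fls_X_times_conv_shift fls_shifted_times_simps)
  then have p: "pole_kernel = fls_shift 1 (fps_to_fls h)"
    by (metis nz he pole_kernel_def nonzero_mult_div_cancel_right)
  have k: "fls_nth pole_kernel K = (if K < - 1 then 0 else fps_nth h (nat (K + 1)))" for K
    unfolding p by simp
  have h0: "fps_nth h 0 = 1"
    using arg_cong[OF he, of "\<lambda>f. fps_nth f 0"] by (simp add: e0)
  have h1: "fps_nth h 1 = 0"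
    using arg_cong[OF he, of "\<lambda>f. fps_nth f 1"] e
    by (simp add: fps_mult_nth e0 h0)
  have "fps_nth h 2 + fps_nth e 2 = 1/8"
    using arg_cong[OF he, of "\<lambda>f. fps_nth f 2"] h0 h1 e0
    by (simp add: fps_mult_nth numeral_2_eq_2 power2_eq_square field_simps)
  then have "fps_nth h 2 = 1/8 - 1/6"
    by (metis e(2) add_diff_cancel_right')
  then have h2: "fps_nth h 2 = - 1/24"
    by simp
  show "K < - 1 \<Longrightarrow> fls_nth pole_kernel K = 0" "fls_nth pole_kernel (- 1) = 1"
       "fls_nth pole_kernel 0 = 0" "fls_nth pole_kernel 1 = - 1/24"
    using h0 h1 h2 by (simp_all add: k)
qed

text \<open>
  This is \<open>(1 + (e\<^sup>y - 1))\<^sup>c = e\<^bsup>cy\<^esup>\<close> for arbitrary exponents: the left-hand side solves the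
  differential equation \<open>f' = c f\<close> that characterises the exponential series.
\<close>

lemma binomial_compose_exp: "fps_binomial c oo (fps_exp 1 - 1) = fps_exp (c :: complex)"
proof -
  let ?B = "fps_binomial c" and ?E = "fps_exp 1 - 1 :: complex fps"
  have E0: "fps_nth ?E 0 = 0" by simp
  have "fps_deriv ?B * (1 + fps_X) = fps_const c * ?B"
    by (simp add: fps_binomial_deriv)
  then have "(fps_deriv ?B * (1 + fps_X)) oo ?E = (fps_const c * ?B) oo ?E"
    by simp
  then have "(fps_deriv ?B oo ?E) * fps_exp 1 = fps_const c * (?B oo ?E)"
    by (simp add: fps_compose_mult_distrib[OF E0] fps_compose_add_distrib)
  then have "fps_deriv (?B oo ?E) = fps_const c * (?B oo ?E)"
    by (simp add: fps_compose_deriv[OF E0])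
  then show ?thesis
    by (simp add: fps_exp_unique_ODE)
qed

text \<open>
  The finite sum is a complete binomial series, because \<open>(e\<^sup>y - 1)\<^sup>j\<close> starts at \<open>y\<^sup>j\<close>. So this is the
  coefficient of \<open>y\<^sup>m\<close> in \<open>e\<^bsup>dy\<^esup> e\<^bsup>cy\<^esup>\<close>.
\<close>

lemma sum_gbinomial_exp:
  fixes c d :: complex
  shows "(\<Sum>j\<le>m. (c gchoose j) * fps_nth (fps_exp d * (fps_exp 1 - 1) ^ j) m) = (c + d) ^ m / fact m"
proof -
  let ?E = "fps_exp 1 - 1 :: complex fps"
  have low: "fps_nth (?E ^ j) l = 0" if "l < j" for j l
    using that by (intro startsby_zero_power_prefix[rule_format]) auto
  have "(\<Sum>j\<le>m. (c gchoose j) * fps_nth (fps_exp d * ?E ^ j) m) =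
        (\<Sum>j\<le>m. \<Sum>i\<le>m. fps_nth (fps_exp d) i * ((c gchoose j) * fps_nth (?E ^ j) (m - i)))"
    by (simp only: fps_mult_nth sum_distrib_left mult.left_commute atLeast0AtMost)
  also have "\<dots> = (\<Sum>i\<le>m. fps_nth (fps_exp d) i * (\<Sum>j\<le>m. (c gchoose j) * fps_nth (?E ^ j) (m - i)))"
    by (subst sum.swap) (simp only: sum_distrib_left)
  also have "\<dots> = (\<Sum>i\<le>m. fps_nth (fps_exp d) i * fps_nth (fps_binomial c oo ?E) (m - i))"
  proof (intro sum.cong refl arg_cong2[where f = "(*)"])
    fix i
    show "(\<Sum>j\<le>m. (c gchoose j) * fps_nth (?E ^ j) (m - i)) = fps_nth (fps_binomial c oo ?E) (m - i)"
      unfolding fps_compose_nth fps_binomial_nth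
      by (intro sum.mono_neutral_right) (auto simp: low)
  qed
  also have "\<dots> = fps_nth (fps_exp d * fps_exp c) m"
    by (simp only: binomial_compose_exp fps_mult_nth atLeast0AtMost)
  also have "\<dots> = (c + d) ^ m / fact m"
    by (simp add: add.commute flip: fps_exp_add_mult)
  finally show ?thesis .
qed

lemma psi_psi_star_vec:
  "n > 0 \<Longrightarrow> psi n psi_star_vec = 0"
  "psi 0 psi_star_vec = vac"
  "n < 0 \<Longrightarrow> psi n psi_star_vec = basis_vec {|n, 0|}"
proof -
  have "{j::int. j |\<in>| {|0|} \<and> j < 0} = {}" by auto
  then have "place_sign 0 {|0|} = 1" by (simp only: place_sign_def card.empty power_0)
  then show "n > 0 \<Longrightarrow> psi n psi_star_vec = 0" "psi 0 psi_star_vec = vac"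
      "n < 0 \<Longrightarrow> psi n psi_star_vec = basis_vec {|n, 0|}"
    using basis_vec_least[of "{|0|}" n]
    by (auto simp: psi_def psi_vec_basis annihilate_basis vac_def cscale_algebra)
qed

text \<open>
  Only the modes \<open>\<psi>(n)\<close> of index \<open>n \<le> 0\<close> survive on \<open>\<psi>*\<close>. The mode \<open>n = 0\<close> gives the vacuum
  and the pole, and \<open>n = -j-1\<close> gives a pair, with a coefficient that vanishes to order \<open>j\<close> in \<open>y\<close>.
\<close>

lemma Y_bracket_psi_psi_star:
  "Y_bracket_coeff psi_vec psi_star_vec K = cscale (fls_nth pole_kernel K) vac +
     (\<Sum>j\<in>{j. int j \<le> K}. cscale (fps_nth (fps_exp (1/2) * (fps_exp 1 - 1) ^ j) (nat K))
        (basis_vec {|- int j - 1, 0|}))"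
proof -
  let ?c = "\<lambda>n. fls_nth (fps_to_fls (fps_exp (1/2)) * exp_minus_one powi (- n - 1)) K"
  let ?E = "fps_exp 1 - 1 :: complex fps"
  define J where "J = {j. int j \<le> K}"
  have fin: "finite J"
    unfolding J_def by (rule finite_subset[of _ "{..nat K}"]) auto
  have z: "0 \<notin> (\<lambda>j. - int j - 1) ` J" by auto
  have inj: "inj_on (\<lambda>j. - int j - 1) J" by (simp add: inj_on_def)
  \<comment> \<open>For negative \<open>n\<close> the power of \<open>e\<^sup>y - 1\<close> is a power series and \<open>K\<close> is a natural number
    wherever the coefficient does not vanish.\<close>
  have pos: "?c (- int j - 1) = (if K < 0 then 0 else fps_nth (fps_exp (1/2) * ?E ^ j) (nat K))" for j
  proof -
    have "fps_to_fls (fps_exp (1/2)) * exp_minus_one powi (- (- int j - 1) - 1) =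
        fps_to_fls (fps_exp (1/2) * ?E ^ j)"
      by (simp add: exp_minus_one_def fps_to_fls_power fls_times_fps_to_fls del: fps_to_fls_minus)
    then show ?thesis by (simp only: fps_to_fls_nth)
  qed
  have low: "?c (- int j - 1) = 0" if "int j > K" for j
  proof -
    have "fps_nth (?E ^ j) l = 0" if "l \<le> nat K" "K \<ge> 0" for l
      using that \<open>int j > K\<close> by (intro startsby_zero_power_prefix[rule_format]) auto
    then show ?thesis
      unfolding pos by (auto simp: fps_mult_nth intro!: sum.neutral)
  qed
  have "Y_bracket_coeff psi_vec psi_star_vec K = Sum_any (\<lambda>n. cscale (?c n) (psi n psi_star_vec))"
  proof -
    have "wt (basis_vec {|- 1|}) = 1/2"
      using wt_psi by (simp only: psi_vec_basis)
    then have "complex_of_rat (wt (basis_vec {|- 1|})) = 1/2"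
      by (simp only: of_rat_divide of_rat_1 of_rat_numeral_eq)
    then show ?thesis
      by (simp only: Y_bracket_coeff_def psi_vec_basis(1) lin_ext_basis_vec flip: Y_mode_generators(1))
  qed
  also have "\<dots> = (\<Sum>n\<in>insert 0 ((\<lambda>j. - int j - 1) ` J). cscale (?c n) (psi n psi_star_vec))"
  proof (rule Sum_any.expand_superset)
    show "{n. cscale (?c n) (psi n psi_star_vec) \<noteq> 0} \<subseteq> insert 0 ((\<lambda>j. - int j - 1) ` J)"
    proof
      fix n assume "n \<in> {n. cscale (?c n) (psi n psi_star_vec) \<noteq> 0}"
      then have n: "?c n \<noteq> 0" "psi n psi_star_vec \<noteq> 0" by (auto simp: cscale_algebra)
      then have "n \<le> 0" using psi_psi_star_vec(1)[of n] by force
      then consider "n = 0" | j where "n = - int j - 1"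
      proof (cases "n = 0")
        case False
        then have "n = - int (nat (- n - 1)) - 1" using \<open>n \<le> 0\<close> by simp
        then show ?thesis by (rule that(2))
      qed (rule that(1))
      then show "n \<in> insert 0 ((\<lambda>j. - int j - 1) ` J)"
      proof cases
        case (2 j)
        have "?c (- int j - 1) \<noteq> 0" using n(1)[unfolded 2] .
        then have "\<not> int j > K" using low[of j] by blast
        then have "j \<in> J" by (simp add: J_def)
        then show ?thesis by (simp add: 2)
      qed simp
    qed
  qed (use fin in simp)
  also have "\<dots> = cscale (?c 0) vac +
      (\<Sum>j\<in>J. cscale (?c (- int j - 1)) (psi (- int j - 1) psi_star_vec))"
    by (simp only: sum.insert[OF finite_imageI[OF fin] z] sum.reindex[OF inj] comp_def psi_psi_star_vec(2))
  also have "?c 0 = fls_nth pole_kernel K"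
    by (simp only: pole_kernel_def divide_inverse minus_zero diff_0 power_int_minus1_right)
  also have "(\<Sum>j\<in>J. cscale (?c (- int j - 1)) (psi (- int j - 1) psi_star_vec)) =
     (\<Sum>j\<in>J. cscale (fps_nth (fps_exp (1/2) * ?E ^ j) (nat K)) (basis_vec {|- int j - 1, 0|}))"
  proof (rule sum.cong)
    fix j assume "j \<in> J"
    then have "\<not> K < 0" by (simp add: J_def)
    moreover have "psi (- int j - 1) psi_star_vec = basis_vec {|- int j - 1, 0|}"
      by (rule psi_psi_star_vec(3)) simp
    ultimately show "cscale (?c (- int j - 1)) (psi (- int j - 1) psi_star_vec) =
        cscale (fps_nth (fps_exp (1/2) * ?E ^ j) (nat K)) (basis_vec {|- int j - 1, 0|})"
      by (simp only: pos if_False)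
  qed simp
  finally show ?thesis unfolding J_def .
qed

text \<open>
  At \<open>S\<close>, the coefficient of \<open>y\<^sup>K\<close> in
  \<open>1 / (2 sinh(y/2)) + \<Sum>\<^sub>k \<plusminus> e\<^bsup>-(k+1/2)y\<^esup>\<close>, with \<open>k\<close> ranging over \<open>S\<close>. Both families of
  operators in the statement have these eigenvalues, which is why they agree.
\<close>

definition zero_mode_eigenvalue :: "int \<Rightarrow> int fset \<Rightarrow> complex" where
  "zero_mode_eigenvalue K S = fls_nth pole_kernel K +
     (if K < 0 then 0 else signed_sum (\<lambda>k. (- (of_int k + 1/2)) ^ nat K / fact (nat K)) S)"

lemma o_mode_linear:
  "o_mode (a + b) v = o_mode a v + o_mode b v"
  "o_mode (cscale c a) v = cscale c (o_mode a v)"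
  "o_mode (\<Sum>i\<in>A. f i) v = (\<Sum>i\<in>A. o_mode (f i) v)"
proof -
  show add: "o_mode (a + b) v = o_mode a v + o_mode b v" for a b
    by (simp add: o_mode_def lin_ext_add)
  show "o_mode (cscale c a) v = cscale c (o_mode a v)"
    by (simp add: o_mode_def lin_ext_cscale)
  show "o_mode (\<Sum>i\<in>A. f i) v = (\<Sum>i\<in>A. o_mode (f i) v)"
    by (induction A rule: infinite_finite_induct) (simp_all add: add, simp_all add: o_mode_def)
qed

lemma o_mode_vac: "o_mode vac v = v"
proof -
  have "\<lfloor>- 1 :: rat\<rfloor> = - 1" by (simp add: floor_eq_iff)
  then show ?thesis
    using wt_vac Y_mode_vac by (simp add: o_mode_def vac_def Y_mode_rat_def)
qed

lemma o_mode_pair: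
  "o_mode (basis_vec {|- int j - 1, 0|}) = pair_sum (\<lambda>k. of_int (- k - 1) gchoose j)"
proof
  fix v
  let ?w = "wt (basis_vec {|- int j - 1, 0|}) - 1"
  have "?w = of_int (int j)"
    using wt_pair[of "- int j - 1"] by simp
  then have "o_mode (basis_vec {|- int j - 1, 0|}) v = Y_mode (basis_vec {|- int j - 1, 0|}) (int j) v"
    by (simp only: o_mode_def lin_ext_basis_vec Y_mode_rat_def Ints_of_int floor_of_int if_True)
  then show "o_mode (basis_vec {|- int j - 1, 0|}) v = pair_sum (\<lambda>k. of_int (- k - 1) gchoose j) v"
    using Y_mode_pair[of "- int j - 1" 0] by simp
qed

lemma diagonal_op_o_mode:
  "diagonal_op (o_mode (Y_bracket_coeff psi_vec psi_star_vec K)) (zero_mode_eigenvalue K)"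
  unfolding diagonal_op_def
proof (intro allI)
  fix c S
  let ?e = "\<lambda>j. fps_nth (fps_exp (1/2) * (fps_exp 1 - 1) ^ j) (nat K) :: complex"
  let ?g = "\<lambda>j k. complex_of_int (- k - 1) gchoose j"
  have "(\<Sum>j\<in>{j. int j \<le> K}. ?e j * signed_sum (?g j) S) =
      signed_sum (\<lambda>k. \<Sum>j\<in>{j. int j \<le> K}. ?g j k * ?e j) S"
    unfolding signed_sum_def sum_distrib_left
    by (subst sum.swap) (simp only: mult_ac)
  also have "\<dots> = (if K < 0 then 0 else signed_sum (\<lambda>k. (- (of_int k + 1/2)) ^ nat K / fact (nat K)) S)"
  proof (cases "K < 0")
    case True
    then have "{j. int j \<le> K} = {}" by auto
    then show ?thesis using True by (simp add: signed_sum_def)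
  next
    case False
    then have "{j. int j \<le> K} = {..nat K}" by auto
    moreover have "complex_of_int (- k - 1) + 1/2 = - (of_int k + 1/2)" for k by simp
    ultimately show ?thesis using False by (simp only: sum_gbinomial_exp if_False)
  qed
  finally have "fls_nth pole_kernel K + (\<Sum>j\<in>{j. int j \<le> K}. ?e j * signed_sum (?g j) S) =
      zero_mode_eigenvalue K S"
    by (simp add: zero_mode_eigenvalue_def)
  moreover have "o_mode (Y_bracket_coeff psi_vec psi_star_vec K) (cscale c (basis_vec S)) =
      cscale ((fls_nth pole_kernel K + (\<Sum>j\<in>{j. int j \<le> K}. ?e j * signed_sum (?g j) S)) * c) (basis_vec S)"
    by (simp add: Y_bracket_psi_psi_star o_mode_linear o_mode_vac o_mode_pair
        diagonal_opD[OF diagonal_op_pair_sum] cscale_algebra distrib_right cscale_add_left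
        sum_distrib_right cscale_sum_left mult.assoc del: of_int_diff of_int_minus)
  ultimately show "o_mode (Y_bracket_coeff psi_vec psi_star_vec K) (cscale c (basis_vec S)) =
      cscale (zero_mode_eigenvalue K S * c) (basis_vec S)"
    by simp
qed

lemma X_coeff_zero: "X_coeff u 0 = o_mode u"
  by (simp add: fun_eq_iff X_coeff_def o_mode_def)

lemma diagonal_op_L_bar: "diagonal_op (L_bar r) (\<lambda>S. fact r * zero_mode_eigenvalue (int r) S)"
  unfolding diagonal_op_def
proof (intro allI)
  fix c S
  have "L_bar r (cscale c (basis_vec S)) =
      pair_sum (\<lambda>k. (- (of_int k + 1/2)) ^ r) (cscale c (basis_vec S))
      + cscale (fact r * fls_nth pole_kernel (int r)) (cscale c (basis_vec S))"
    by (simp add: L_bar_def normal_pair_coeff_def pair_sum_def pole_kernel_def cong: if_cong)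
  also have "\<dots> = cscale ((signed_sum (\<lambda>k. (- (of_int k + 1/2)) ^ r) S
      + fact r * fls_nth pole_kernel (int r)) * c) (basis_vec S)"
    by (simp only: diagonal_opD[OF diagonal_op_pair_sum] cscale_algebra distrib_right cscale_add_left)
  also have "signed_sum (\<lambda>k. (- (of_int k + 1/2)) ^ r) S + fact r * fls_nth pole_kernel (int r) =
      fact r * zero_mode_eigenvalue (int r) S"
    by (simp add: zero_mode_eigenvalue_def signed_sum_def distrib_left sum_distrib_left)
  finally show "L_bar r (cscale c (basis_vec S)) =
      cscale (fact r * zero_mode_eigenvalue (int r) S * c) (basis_vec S)" .
qed

lemma zero_mode_eigenvalue_1: "zero_mode_eigenvalue 1 S = of_real (energy S - 1/24)"
  using energy_signed_sum[of S] by (simp add: zero_mode_eigenvalue_def pole_kernel_nth)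

lemma diagonal_op_L0_bar: "diagonal_op L0_bar (zero_mode_eigenvalue 1)"
  by (simp add: diagonal_op_def L0_bar_def diagonal_opD[OF diagonal_op_L0] zero_mode_eigenvalue_1
      cscale_algebra left_diff_distrib cscale_diff_left)

lemma signed_sum_1: "signed_sum (\<lambda>_. 1) S = of_int (charge S)"
proof -
  have "signed_sum (\<lambda>_. 1) S = (\<Sum>k\<in>fset S. if k < 0 then 1 else - 1)"
    by (simp add: signed_sum_def cong: if_cong)
  also have "\<dots> = of_int (charge S)"
    by (simp add: sum.If_cases charge_def Int_def not_less)
  finally show ?thesis .
qed

text \<open>
  These are the cases in which \<open>\<sigma>\<close> has no derivative. The charge must vanish for \<open>K = 0\<close>,
  as the zero mode is then the charge operator.
\<close>

lemma zero_mode_eigenvalue_low: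
  "K < - 1 \<Longrightarrow> zero_mode_eigenvalue K S = 0"
  "zero_mode_eigenvalue (- 1) S = 1"
  "charge S = 0 \<Longrightarrow> zero_mode_eigenvalue 0 S = 0"
  using signed_sum_1[of S] by (simp_all add: zero_mode_eigenvalue_def pole_kernel_nth)

section \<open>Growth of eigenvalues and convergence of traces\<close>

lemma energy_nonneg: "energy S \<ge> 0"
  by (simp add: energy_def sum_nonneg)

text \<open>
  The modes \<open>k\<close> and \<open>-k-1\<close> have the same energy, so the sum is at most twice a geometric series.
\<close>

lemma sum_exp_mode_le:
  assumes "t > 0" "finite K"
  shows "(\<Sum>k\<in>K. exp (- t * \<bar>of_int k + 1/2\<bar>)) \<le> 2 / (1 - exp (- t :: real))"
proof -
  let ?a = "\<lambda>k::int. exp (- t * \<bar>of_int k + 1/2\<bar>)"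
  have geo: "(\<Sum>n<N. exp (- t * (real n + 1/2))) \<le> 1 / (1 - exp (- t))" for N
  proof -
    have "(\<Sum>n<N. exp (- t * (real n + 1/2))) \<le> (\<Sum>n<N. exp (- t) ^ n)"
      using assms by (intro sum_mono) (simp add: exp_of_nat_mult [symmetric] algebra_simps)
    also have "\<dots> \<le> suminf (\<lambda>n. exp (- t) ^ n)"
      using assms by (intro sum_le_suminf summable_geometric) auto
    also have "\<dots> = 1 / (1 - exp (- t))"
      using assms by (intro suminf_geometric) simp
    finally show ?thesis .
  qed
  define N where "N = Suc (nat (Max ((\<lambda>k. \<bar>k\<bar>) ` insert 0 K)))"
  have N: "\<bar>k\<bar> < int N" if "k \<in> K" for k
  proof -
    have "\<bar>k\<bar> \<le> Max ((\<lambda>k. \<bar>k\<bar>) ` insert 0 K)" using that assms by (intro Max_ge) auto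
    then show ?thesis unfolding N_def by linarith
  qed
  have "K \<subseteq> int ` {..<N} \<union> (\<lambda>n. - int n - 1) ` {..<N}"
  proof
    fix k assume "k \<in> K"
    note N[OF this]
    then have "k = int (nat k) \<and> nat k < N \<or> k = - int (nat (- k - 1)) - 1 \<and> nat (- k - 1) < N"
      by linarith
    then show "k \<in> int ` {..<N} \<union> (\<lambda>n. - int n - 1) ` {..<N}" by blast
  qed
  then have "sum ?a K \<le> sum ?a (int ` {..<N} \<union> (\<lambda>n. - int n - 1) ` {..<N})"
    by (intro sum_mono2) auto
  also have "\<dots> \<le> sum ?a (int ` {..<N}) + sum ?a ((\<lambda>n. - int n - 1) ` {..<N})"
    by (subst sum.union_disjoint) auto
  also have "\<dots> = (\<Sum>n<N. exp (- t * (real n + 1/2))) + (\<Sum>n<N. exp (- t * (real n + 1/2)))"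
  proof -
    have "sum ?a (int ` {..<N}) = (\<Sum>n<N. exp (- t * (real n + 1/2)))"
      by (subst sum.reindex) (auto simp: inj_on_def)
    moreover have "\<bar>- real n - 1/2\<bar> = real n + 1/2" for n by linarith
    then have "sum ?a ((\<lambda>n. - int n - 1) ` {..<N}) = (\<Sum>n<N. exp (- t * (real n + 1/2)))"
      by (subst sum.reindex) (auto simp: inj_on_def)
    ultimately show ?thesis by simp
  qed
  also have "\<dots> \<le> 2 / (1 - exp (- t))"
    using geo[of N] by simp
  finally show ?thesis .
qed

text \<open>
  The uniform bound comes from the product formula for the partition function: enlarging the
  family of sets to all subsets of their union \<open>U\<close> gives \<open>\<Prod>\<^sub>k (1 + e\<^bsup>-t |k+1/2|\<^esup>)\<close> over \<open>U\<close>,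
  and \<open>1 + x \<le> e\<^sup>x\<close> reduces this to a sum over single modes.
\<close>

lemma sum_exp_energy_le:
  assumes "t > 0" "finite F"
  shows "(\<Sum>S\<in>F. exp (- t * energy S)) \<le> exp (2 / (1 - exp (- t)))"
proof -
  let ?a = "\<lambda>k::int. exp (- t * \<bar>of_int k + 1/2\<bar>)"
  define U where "U = (\<Union>S\<in>F. fset S)"
  have U: "finite U" using assms by (simp add: U_def)
  have "(\<Sum>S\<in>F. exp (- t * energy S)) = (\<Sum>S\<in>F. \<Prod>k\<in>fset S. ?a k)"
    by (simp add: energy_def sum_distrib_left exp_sum)
  also have "\<dots> = (\<Sum>T\<in>fset ` F. \<Prod>k\<in>T. ?a k)"
    by (subst sum.reindex) (auto simp: inj_on_def fset_inject)
  also have "\<dots> \<le> (\<Sum>T\<in>Pow U. \<Prod>k\<in>T. ?a k)"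
    using U by (intro sum_mono2) (auto simp: U_def intro!: prod_nonneg)
  also have "\<dots> = (\<Prod>k\<in>U. ?a k + 1)"
    by (simp add: prod_add[OF U])
  also have "\<dots> \<le> (\<Prod>k\<in>U. exp (?a k))"
    by (intro prod_mono) (auto simp: add.commute intro: add_nonneg_nonneg)
  also have "\<dots> = exp (\<Sum>k\<in>U. ?a k)"
    by (simp add: exp_sum U)
  also have "\<dots> \<le> exp (2 / (1 - exp (- t)))"
    using sum_exp_mode_le[OF assms(1) U] by simp
  finally show ?thesis .
qed

lemma summable_exp_energy:
  assumes "t > 0"
  shows "(\<lambda>S. exp (- t * energy S)) summable_on A"
proof (rule nonneg_bdd_above_summable_on)
  show "bdd_above (sum (\<lambda>S. exp (- t * energy S)) ` {F. F \<subseteq> A \<and> finite F})"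
    by (rule bdd_aboveI2[where M = "exp (2 / (1 - exp (- t)))"]) (use sum_exp_energy_le[OF assms] in auto)
qed simp

text \<open>
  This growth condition is weaker than a polynomial bound in the energy, is closed under products,
  and is enough for convergence against \<open>e\<^bsup>-t L(0)\<^esup>\<close>.
\<close>

definition subexponential :: "(int fset \<Rightarrow> complex) \<Rightarrow> bool" where
  "subexponential P \<longleftrightarrow> (\<forall>\<epsilon>>0. \<exists>C. \<forall>S. norm (P S) \<le> C * exp (\<epsilon> * energy S))"

lemma subexponentialE:
  assumes "subexponential P" "\<epsilon> > 0"
  obtains C where "\<And>S. norm (P S) \<le> C * exp (\<epsilon> * energy S)"
proof -
  have "\<exists>C. \<forall>S. norm (P S) \<le> C * exp (\<epsilon> * energy S)"
    using assms by (simp add: subexponential_def)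
  then show ?thesis using that by blast
qed

lemma subexponential_const: "subexponential (\<lambda>_. c)"
  unfolding subexponential_def
proof (intro allI impI exI)
  fix \<epsilon> :: real and S assume "\<epsilon> > 0"
  then have "1 \<le> exp (\<epsilon> * energy S)" using energy_nonneg[of S] by simp
  then show "norm c \<le> norm c * exp (\<epsilon> * energy S)"
    by (simp add: mult_le_cancel_left1)
qed

lemma subexponential_mult:
  assumes "subexponential P" "subexponential Q"
  shows "subexponential (\<lambda>S. P S * Q S)"
  unfolding subexponential_def
proof (intro allI impI)
  fix \<epsilon> :: real assume "\<epsilon> > 0"
  then have "\<epsilon> / 2 > 0" by simp
  obtain C where C: "\<And>S. norm (P S) \<le> C * exp (\<epsilon> / 2 * energy S)"
    using subexponentialE[OF assms(1) \<open>\<epsilon> / 2 > 0\<close>] by blast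
  obtain D where D: "\<And>S. norm (Q S) \<le> D * exp (\<epsilon> / 2 * energy S)"
    using subexponentialE[OF assms(2) \<open>\<epsilon> / 2 > 0\<close>] by blast
  have "norm (P S * Q S) \<le> C * D * exp (\<epsilon> * energy S)" for S
  proof -
    have "norm (P S) * norm (Q S) \<le> (C * exp (\<epsilon> / 2 * energy S)) * (D * exp (\<epsilon> / 2 * energy S))"
      by (intro mult_mono C D order_trans[OF norm_ge_zero C]) simp
    also have "\<dots> = C * D * exp (\<epsilon> * energy S)"
      by (simp flip: exp_add)
    finally show ?thesis by (simp add: norm_mult)
  qed
  then show "\<exists>C. \<forall>S. norm (P S * Q S) \<le> C * exp (\<epsilon> * energy S)" by blast
qed

lemma subexponential_power: "subexponential P \<Longrightarrow> subexponential (\<lambda>S. P S ^ n)"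
  by (induction n) (auto intro: subexponential_const subexponential_mult)

lemma subexponential_prod:
  "(\<And>i. i \<in> I \<Longrightarrow> subexponential (P i)) \<Longrightarrow> subexponential (\<lambda>S. \<Prod>i\<in>I. P i S)"
  by (induction I rule: infinite_finite_induct) (auto intro: subexponential_const subexponential_mult)

lemma subexponential_prod_list:
  "(\<And>k. subexponential (P k)) \<Longrightarrow> subexponential (\<lambda>S. \<Prod>k\<leftarrow>ks. P k S)"
  by (induction ks) (auto intro: subexponential_const subexponential_mult)

lemma power_le_exp:
  assumes "x \<ge> (0::real)"
  shows "x ^ n \<le> fact n * exp x"
proof -
  have "(\<Sum>k<Suc n. x ^ k /\<^sub>R fact k) \<le> exp x"
    unfolding exp_def using assms by (intro sum_le_suminf summable_exp_generic) auto
  moreover have "x ^ n /\<^sub>R fact n \<le> (\<Sum>k<Suc n. x ^ k /\<^sub>R fact k)"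
    using assms by (simp add: sum_nonneg)
  ultimately show ?thesis by (simp add: field_simps)
qed

text \<open>
  A sum of powers \<open>|k+1/2|\<^sup>m\<close> over \<open>S\<close> is bounded by a power of the energy. Since
  \<open>|k+1/2| \<ge> 1/2\<close>, an additional factor \<open>2 |k+1/2|\<close> does not decrease the summands; it makes the
  bound \<open>2 E\<^bsup>m+1\<^esup>\<close> work for \<open>m = 0\<close> as well.
\<close>

lemma subexponential_eigenvalue: "subexponential (zero_mode_eigenvalue K)"
  unfolding subexponential_def
proof (intro allI impI)
  fix \<epsilon> :: real assume \<epsilon>: "\<epsilon> > 0"
  define m c where "m = nat K" and "c = norm (fls_nth pole_kernel K)"
  have sum: "norm (signed_sum (\<lambda>k. (- (of_int k + 1/2)) ^ m / fact m) S) \<le> 2 * energy S ^ Suc m" for S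
  proof -
    have "norm (signed_sum (\<lambda>k. (- (of_int k + 1/2)) ^ m / fact m) S) \<le>
        (\<Sum>k\<in>fset S. norm ((if k < 0 then 1 else - 1) * ((- (of_int k + 1/2)) ^ m / fact m) :: complex))"
      unfolding signed_sum_def by (rule norm_sum)
    also have "\<dots> \<le> (\<Sum>k\<in>fset S. 2 * \<bar>of_int k + 1/2\<bar> * energy S ^ m)"
    proof (rule sum_mono)
      fix k assume k: "k \<in> fset S"
      have e: "\<bar>of_int k + 1/2\<bar> \<le> energy S"
        unfolding energy_def by (rule member_le_sum[OF k]) auto
      have "norm (complex_of_int k + 1/2) = norm (complex_of_real (of_int k + 1/2))" by simp
      also have "\<dots> = \<bar>of_int k + 1/2\<bar>" by (simp only: norm_of_real)
      finally have n: "norm (complex_of_int k + 1/2) = \<bar>of_int k + 1/2\<bar>" .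
      have "norm ((if k < 0 then 1 else - 1) * ((- (of_int k + 1/2)) ^ m / fact m) :: complex)
          = \<bar>of_int k + 1/2\<bar> ^ m / fact m"
        by (simp add: norm_mult norm_divide norm_power n norm_minus_cancel del: minus_add_distrib)
      also have "\<dots> \<le> \<bar>of_int k + 1/2\<bar> ^ m"
        by (simp add: divide_le_eq mult_le_cancel_left1)
      also have "\<dots> \<le> energy S ^ m"
        by (intro power_mono e) simp
      also have "\<dots> \<le> 2 * \<bar>of_int k + 1/2\<bar> * energy S ^ m"
      proof -
        have "1 \<le> 2 * \<bar>real_of_int k + 1/2\<bar>"
          by (cases "k \<ge> 0") (auto simp: abs_if)
        then show ?thesis
          using mult_right_mono[of 1 "2 * \<bar>real_of_int k + 1/2\<bar>" "energy S ^ m"] energy_nonneg[of S] by simp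
      qed
      finally show "norm ((if k < 0 then 1 else - 1) * ((- (of_int k + 1/2)) ^ m / fact m) :: complex)
          \<le> 2 * \<bar>of_int k + 1/2\<bar> * energy S ^ m" .
    qed
    also have "\<dots> = 2 * energy S ^ Suc m"
      by (simp add: energy_def sum_distrib_left sum_distrib_right mult.assoc)
    finally show ?thesis .
  qed
  have "norm (zero_mode_eigenvalue K S) \<le>
      (c + 2 * fact (Suc m) / \<epsilon> ^ Suc m) * exp (\<epsilon> * energy S)" for S
  proof -
    have "norm (zero_mode_eigenvalue K S) \<le> c + 2 * energy S ^ Suc m"
    proof (cases "K < 0")
      case True
      then show ?thesis using energy_nonneg[of S] by (simp add: zero_mode_eigenvalue_def c_def)
    next
      case False
      then show ?thesis
        using norm_triangle_le[OF add_left_mono[OF sum]]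
        by (simp add: zero_mode_eigenvalue_def c_def m_def)
    qed
    also have "\<dots> \<le> c * exp (\<epsilon> * energy S) + 2 * (fact (Suc m) * exp (\<epsilon> * energy S) / \<epsilon> ^ Suc m)"
    proof (intro add_mono mult_left_mono)
      show "c \<le> c * exp (\<epsilon> * energy S)"
        using \<epsilon> energy_nonneg[of S] by (simp add: mult_le_cancel_left1 c_def)
      have "(\<epsilon> * energy S) ^ Suc m \<le> fact (Suc m) * exp (\<epsilon> * energy S)"
        using \<epsilon> energy_nonneg[of S] by (intro power_le_exp) simp
      then show "energy S ^ Suc m \<le> fact (Suc m) * exp (\<epsilon> * energy S) / \<epsilon> ^ Suc m"
        using \<epsilon> by (simp add: pos_le_divide_eq power_mult_distrib mult_ac del: power_Suc fact_Suc)
    qed simp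
    also have "\<dots> = (c + 2 * fact (Suc m) / \<epsilon> ^ Suc m) * exp (\<epsilon> * energy S)"
      by (simp add: distrib_right)
    finally show ?thesis .
  qed
  then show "\<exists>C. \<forall>S. norm (zero_mode_eigenvalue K S) \<le> C * exp (\<epsilon> * energy S)" by blast
qed

text \<open>
  Weierstrass' test gives uniform convergence on a disc around \<open>\<tau>\<close>, and locally uniform limits of
  holomorphic functions may be differentiated termwise.
\<close>

lemma deriv_trace:
  fixes A :: "int fset set"
  assumes P: "subexponential P" and \<tau>: "Im \<tau> > 0"
  defines "w \<equiv> \<lambda>S. 2 * of_real pi * \<i> * zero_mode_eigenvalue 1 S"
  shows "deriv (\<lambda>\<tau>. \<Sum>\<^sub>\<infinity>S\<in>A. P S * exp (\<tau> * w S)) \<tau> = (\<Sum>\<^sub>\<infinity>S\<in>A. P S * w S * exp (\<tau> * w S))"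
proof -
  define t where "t = Im \<tau>"
  have t: "t > 0" using \<tau> by (simp add: t_def)
  then have "pi * t / 2 > 0" by simp
  then obtain C where C: "\<And>S. norm (P S) \<le> C * exp (pi * t / 2 * energy S)"
    using subexponentialE[OF P] by blast
  \<comment> \<open>On the disc of radius \<open>t/2\<close> the imaginary part lies between \<open>t/2\<close> and \<open>3t/2\<close>. This gives a
    decay \<open>e\<^bsup>-\<pi> t E\<^esup>\<close>, half of which absorbs \<open>P\<close>; the shift by \<open>1/24\<close> costs at most
    \<open>e\<^bsup>\<pi> t / 8\<^esup>\<close>.\<close>
  define M where "M = (\<lambda>S. C * exp (pi * t / 8) * exp (- (pi * t / 2) * energy S))"
  have bound: "norm (P S * exp (z * w S)) \<le> M S" if z: "z \<in> cball \<tau> (t / 2)" for z S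
  proof -
    have "\<bar>Im (\<tau> - z)\<bar> \<le> t / 2"
      using z abs_Im_le_cmod[of "\<tau> - z"] by (simp add: dist_norm)
    then have Im: "t / 2 \<le> Im z" "Im z \<le> 3 * t / 2"
      by (auto simp: t_def abs_if split: if_splits)
    have "Re (z * w S) = - (2 * pi * Im z) * (energy S - 1/24)"
      by (simp add: w_def zero_mode_eigenvalue_1 del: of_real_diff)
    also have "\<dots> = pi * Im z / 12 - 2 * pi * Im z * energy S"
      by (simp add: algebra_simps)
    also have "\<dots> \<le> pi * t / 8 - pi * t * energy S"
    proof (rule diff_mono)
      show "pi * Im z / 12 \<le> pi * t / 8"
        using mult_left_mono[OF Im(2), of pi] by simp
      show "pi * t * energy S \<le> 2 * pi * Im z * energy S"
        using mult_left_mono[OF Im(1), of "2 * pi"] energy_nonneg[of S]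
        by (intro mult_right_mono) simp_all
    qed
    finally have "norm (exp (z * w S)) \<le> exp (pi * t / 8 - pi * t * energy S)" by simp
    then have "norm (P S) * norm (exp (z * w S)) \<le>
        (C * exp (pi * t / 2 * energy S)) * exp (pi * t / 8 - pi * t * energy S)"
      by (intro mult_mono C order_trans[OF norm_ge_zero C]) simp_all
    also have "\<dots> = M S"
      by (simp add: M_def mult.assoc flip: exp_add)
    finally show ?thesis by (simp add: norm_mult)
  qed
  have "M summable_on A"
    unfolding M_def by (intro summable_on_cmult_right summable_exp_energy) (use t in simp)
  then have unif: "uniform_limit (cball \<tau> (t / 2)) (\<lambda>F z. \<Sum>S\<in>F. P S * exp (z * w S))
      (\<lambda>z. \<Sum>\<^sub>\<infinity>S\<in>A. P S * exp (z * w S)) (finite_subsets_at_top A)"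
    by (intro Weierstrass_m_test_general[where M = M] bound)
  obtain g' where g': "\<And>z. z \<in> ball \<tau> (t / 2) \<Longrightarrow>
      ((\<lambda>z. \<Sum>\<^sub>\<infinity>S\<in>A. P S * exp (z * w S)) has_field_derivative g' z) (at z) \<and>
      ((\<lambda>F. \<Sum>S\<in>F. P S * w S * exp (z * w S)) \<longlongrightarrow> g' z) (finite_subsets_at_top A)"
  proof (rule has_complex_derivative_uniform_limit[OF _ unif])
    have d: "((\<lambda>z. \<Sum>S\<in>F. P S * exp (z * w S)) has_field_derivative
        (\<Sum>S\<in>F. P S * w S * exp (z * w S))) (at z)" for F z
      by (rule DERIV_sum) (auto intro!: derivative_eq_intros)
    show "\<forall>\<^sub>F F in finite_subsets_at_top A.
        continuous_on (cball \<tau> (t / 2)) (\<lambda>z. \<Sum>S\<in>F. P S * exp (z * w S)) \<and>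
        (\<forall>z\<in>ball \<tau> (t / 2). ((\<lambda>z. \<Sum>S\<in>F. P S * exp (z * w S)) has_field_derivative
           (\<Sum>S\<in>F. P S * w S * exp (z * w S))) (at z))"
      by (intro always_eventually allI conjI ballI)
         (intro continuous_intros d)+
  qed (use t in auto)
  have "\<tau> \<in> ball \<tau> (t / 2)" using t by simp
  note g = g'[OF this]
  then have "((\<lambda>S. P S * w S * exp (\<tau> * w S)) has_sum g' \<tau>) A"
    by (simp add: has_sum_def)
  then have "(\<Sum>\<^sub>\<infinity>S\<in>A. P S * w S * exp (\<tau> * w S)) = g' \<tau>"
    by (rule infsumI)
  with DERIV_imp_deriv[OF conjunct1[OF g]] show ?thesis
    by (rule trans[OF _ sym])
qed

section \<open>The action of sigma on V\<close>

text \<open>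
  The eigenvalue at \<open>S\<close> of the coefficient of \<open>\<Prod>\<^sub>i \<tau>\<^sub>i\<^bsup>\<alpha>(i)\<^esup>\<close> in the exponentials of the
  \<open>L_bar i\<close> with a formal variable.
\<close>

definition formal_eigenvalue :: "(nat \<Rightarrow>\<^sub>0 nat) \<Rightarrow> int fset \<Rightarrow> complex" where
  "formal_eigenvalue \<alpha> S = (\<Prod>i\<in>Poly_Mapping.keys \<alpha>.
     (2 * of_real pi * \<i> * (fact i * zero_mode_eigenvalue (int i) S)) ^ Poly_Mapping.lookup \<alpha> i
       / fact (Poly_Mapping.lookup \<alpha> i))"

lemma formal_eigenvalue_0: "formal_eigenvalue 0 S = 1"
  by (simp add: formal_eigenvalue_def)

lemma subexponential_formal_eigenvalue: "subexponential (formal_eigenvalue \<alpha>)"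
proof -
  have "subexponential (\<lambda>S. \<Prod>i\<in>Poly_Mapping.keys \<alpha>.
     (2 * of_real pi * \<i> * (fact i * zero_mode_eigenvalue (int i) S)) ^ Poly_Mapping.lookup \<alpha> i
       * (1 / fact (Poly_Mapping.lookup \<alpha> i)))"
    by (intro subexponential_prod subexponential_mult subexponential_power subexponential_const
        subexponential_eigenvalue)
  then show ?thesis by (simp add: formal_eigenvalue_def[abs_def])
qed

text \<open>
  The derivative with respect to \<open>\<tau>\<^sub>r\<close> of \<open>exp(2 \<pi> i \<tau>\<^sub>r \<lambda>)\<close> is multiplication by \<open>2 \<pi> i \<lambda>\<close>,
  read off at one coefficient.
\<close>

lemma formal_eigenvalue_single:
  "of_nat (Poly_Mapping.lookup \<alpha> r + 1) * formal_eigenvalue (\<alpha> + Poly_Mapping.single r 1) S =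
   2 * of_real pi * \<i> * fact r * zero_mode_eigenvalue (int r) S * formal_eigenvalue \<alpha> S"
proof -
  let ?x = "\<lambda>i. 2 * of_real pi * \<i> * (fact i * zero_mode_eigenvalue (int i) S)"
  let ?f = "\<lambda>\<beta> i. ?x i ^ Poly_Mapping.lookup \<beta> i / fact (Poly_Mapping.lookup \<beta> i)"
  define K where "K = Poly_Mapping.keys \<alpha>"
  define \<beta> where "\<beta> = \<alpha> + Poly_Mapping.single r 1"
  have look: "Poly_Mapping.lookup \<beta> i = Poly_Mapping.lookup \<alpha> i + (if i = r then 1 else 0)" for i
    by (simp add: \<beta>_def lookup_add lookup_single when_def)
  have fin: "finite K" by (simp add: K_def)
  have "Poly_Mapping.keys \<beta> = insert r K"
    by (auto simp: K_def in_keys_iff look split: if_splits)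
  then have b: "formal_eigenvalue \<beta> S = ?f \<beta> r * (\<Prod>i\<in>K - {r}. ?f \<beta> i)"
    using fin by (simp add: formal_eigenvalue_def prod.insert_remove)
  have "formal_eigenvalue \<alpha> S = (\<Prod>i\<in>insert r K. ?f \<alpha> i)"
    unfolding formal_eigenvalue_def K_def
    by (rule prod.mono_neutral_left) (auto simp: in_keys_iff)
  then have a: "formal_eigenvalue \<alpha> S = ?f \<alpha> r * (\<Prod>i\<in>K - {r}. ?f \<alpha> i)"
    using fin by (simp add: prod.insert_remove)
  have rest: "(\<Prod>i\<in>K - {r}. ?f \<beta> i) = (\<Prod>i\<in>K - {r}. ?f \<alpha> i)"
    by (intro prod.cong refl) (simp add: look)
  have "of_nat (n + 1) * (x ^ (n + 1) / fact (n + 1)) = x * (x ^ n / fact n)" for n and x :: complex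
    by (simp add: fact_Suc del: of_nat_Suc)
  from this[of "Poly_Mapping.lookup \<alpha> r" "?x r"]
  have step: "of_nat (Poly_Mapping.lookup \<alpha> r + 1) * ?f \<beta> r = ?x r * ?f \<alpha> r"
    by (simp only: look simp_thms if_True)
  have "of_nat (Poly_Mapping.lookup \<alpha> r + 1) * formal_eigenvalue \<beta> S =
      (of_nat (Poly_Mapping.lookup \<alpha> r + 1) * ?f \<beta> r) * (\<Prod>i\<in>K - {r}. ?f \<alpha> i)"
    unfolding b rest by (rule mult.assoc[symmetric])
  also have "\<dots> = ?x r * formal_eigenvalue \<alpha> S"
    unfolding step a by (rule mult.assoc)
  finally have "of_nat (Poly_Mapping.lookup \<alpha> r + 1) * formal_eigenvalue \<beta> S =
      ?x r * formal_eigenvalue \<alpha> S" .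
  then show ?thesis by (simp only: \<beta>_def mult.assoc)
qed

lemma V_eq_infsum:
  assumes "Poly_Mapping.keys \<alpha> \<subseteq> {2..}"
  shows "V \<alpha> \<tau> = (\<Sum>\<^sub>\<infinity>S\<in>{S. charge S = 0}.
    formal_eigenvalue \<alpha> S * exp (\<tau> * (2 * of_real pi * \<i> * zero_mode_eigenvalue 1 S)))"
proof -
  let ?is = "sorted_list_of_set (Poly_Mapping.keys \<alpha>)"
  let ?A = "\<lambda>i. q_power_coeff (Poly_Mapping.lookup \<alpha> i) (L_bar i)"
  let ?a = "\<lambda>i S. (2 * of_real pi * \<i> * (fact i * zero_mode_eigenvalue (int i) S)) ^ Poly_Mapping.lookup \<alpha> i
       / fact (Poly_Mapping.lookup \<alpha> i)"
  have "diagonal_op (\<lambda>v. foldr ?A ?is (q_power \<tau> (L_bar 1) v))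
     (\<lambda>S. (\<Prod>i\<leftarrow>?is. ?a i S) * exp (2 * of_real pi * \<i> * \<tau> * (fact 1 * zero_mode_eigenvalue (int 1) S)))"
    by (intro diagonal_op_foldr diagonal_op_q_power_coeff diagonal_op_q_power diagonal_op_L_bar)
  moreover have "(\<Prod>i\<leftarrow>?is. ?a i S) = formal_eigenvalue \<alpha> S" for S
    using prod.distinct_set_conv_list[of ?is "\<lambda>i. ?a i S"] by (simp add: formal_eigenvalue_def)
  ultimately show ?thesis
    using assms by (simp add: V_def trace_F0_diagonal mult_ac)
qed

text \<open>
  The induction needs all exponents \<open>\<alpha>\<close>, since each formal derivative reads off a higher
  coefficient, and all \<open>\<tau>\<close> in the upper half-plane, since the derivative with respect to \<open>\<tau>\<^sub>1\<close>
  depends on a neighbourhood.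
\<close>

lemma foldr_sigma_coeff_V:
  assumes "Im \<tau> > 0" "Poly_Mapping.keys \<alpha> \<subseteq> {2..}"
  shows "foldr sigma_coeff ks V \<alpha> \<tau> = (\<Sum>\<^sub>\<infinity>S\<in>{S. charge S = 0}.
    (\<Prod>k\<leftarrow>ks. zero_mode_eigenvalue k S) * formal_eigenvalue \<alpha> S
      * exp (\<tau> * (2 * of_real pi * \<i> * zero_mode_eigenvalue 1 S)))"
  using assms
proof (induction ks arbitrary: \<alpha> \<tau>)
  case Nil
  then show ?case by (simp add: V_eq_infsum)
next
  case (Cons k ks)
  let ?F = "foldr sigma_coeff ks V"
  let ?p = "\<lambda>S. \<Prod>k\<leftarrow>ks. zero_mode_eigenvalue k S"
  let ?w = "\<lambda>S. 2 * of_real pi * \<i> * zero_mode_eigenvalue 1 S"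
  let ?A = "{S. charge S = 0}"
  consider "k = - 1" | "k = 1" | "k \<ge> 2" | "k = 0" | "k < - 1" by linarith
  then show ?case
  proof cases
    case 1
    then show ?thesis using Cons by (simp add: sigma_coeff_def zero_mode_eigenvalue_low)
  next
    case 2
    have "open {\<tau>. Im \<tau> > 0}" by (simp add: open_halfspace_Im_gt)
    then have "\<forall>\<^sub>F z in nhds \<tau>. z \<in> {\<tau>. Im \<tau> > 0}"
      using Cons.prems(1) by (intro eventually_nhds_in_open) auto
    then have "\<forall>\<^sub>F z in nhds \<tau>. ?F \<alpha> z =
        (\<Sum>\<^sub>\<infinity>S\<in>?A. ?p S * formal_eigenvalue \<alpha> S * exp (z * ?w S))"
      by eventually_elim (use Cons in auto)
    then have "deriv (?F \<alpha>) \<tau> =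
        deriv (\<lambda>z. \<Sum>\<^sub>\<infinity>S\<in>?A. ?p S * formal_eigenvalue \<alpha> S * exp (z * ?w S)) \<tau>"
      by (intro deriv_cong_ev refl)
    also have "\<dots> = (\<Sum>\<^sub>\<infinity>S\<in>?A. ?p S * formal_eigenvalue \<alpha> S * ?w S * exp (\<tau> * ?w S))"
      by (intro deriv_trace Cons.prems(1) subexponential_mult subexponential_prod_list
          subexponential_eigenvalue subexponential_formal_eigenvalue)
    finally have "foldr sigma_coeff (k # ks) V \<alpha> \<tau> = 1 / (2 * of_real pi * \<i>) *
        (\<Sum>\<^sub>\<infinity>S\<in>?A. ?p S * formal_eigenvalue \<alpha> S * ?w S * exp (\<tau> * ?w S))"
      using 2 by (simp add: sigma_coeff_def d_tau_def)
    also have "\<dots> = (\<Sum>\<^sub>\<infinity>S\<in>?A. (\<Prod>k\<leftarrow>k # ks. zero_mode_eigenvalue k S) * formal_eigenvalue \<alpha> S * exp (\<tau> * ?w S))"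
      unfolding infsum_cmult_right'[symmetric] using 2 by (intro infsum_cong) (simp add: field_simps)
    finally show ?thesis .
  next
    case 3
    define r where "r = nat k"
    have k: "k = int r" "r \<ge> 2" "r \<noteq> 1" using 3 by (auto simp: r_def)
    let ?\<beta> = "\<alpha> + Poly_Mapping.single r 1"
    let ?c = "1 / (2 * of_real pi * \<i>) * (1 / fact r) * of_nat (Poly_Mapping.lookup \<alpha> r + 1)"
    have "Poly_Mapping.keys ?\<beta> \<subseteq> {2..}"
      using keys_add[of \<alpha> "Poly_Mapping.single r 1"] Cons.prems(2) k(2) by auto
    then have "?F ?\<beta> \<tau> = (\<Sum>\<^sub>\<infinity>S\<in>?A. ?p S * formal_eigenvalue ?\<beta> S * exp (\<tau> * ?w S))"
      by (rule Cons.IH[OF Cons.prems(1)])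
    then have "foldr sigma_coeff (k # ks) V \<alpha> \<tau> =
        ?c * (\<Sum>\<^sub>\<infinity>S\<in>?A. ?p S * formal_eigenvalue ?\<beta> S * exp (\<tau> * ?w S))"
      using k by (simp add: sigma_coeff_def d_tau_def)
    also have "\<dots> = (\<Sum>\<^sub>\<infinity>S\<in>?A. (\<Prod>k\<leftarrow>k # ks. zero_mode_eigenvalue k S) * formal_eigenvalue \<alpha> S * exp (\<tau> * ?w S))"
      unfolding infsum_cmult_right'[symmetric]
    proof (intro infsum_cong)
      fix S
      have "?c * formal_eigenvalue ?\<beta> S = 1 / (2 * of_real pi * \<i>) * (1 / fact r) *
          (2 * of_real pi * \<i> * fact r * zero_mode_eigenvalue (int r) S * formal_eigenvalue \<alpha> S)"
        by (simp only: mult.assoc flip: formal_eigenvalue_single[unfolded mult.assoc])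
      also have "\<dots> = zero_mode_eigenvalue k S * formal_eigenvalue \<alpha> S"
        by (simp add: k)
      finally have *: "?c * formal_eigenvalue ?\<beta> S = zero_mode_eigenvalue k S * formal_eigenvalue \<alpha> S" .
      have "?c * (?p S * formal_eigenvalue ?\<beta> S * exp (\<tau> * ?w S)) =
          (?c * formal_eigenvalue ?\<beta> S) * (?p S * exp (\<tau> * ?w S))"
        by (simp only: mult_ac)
      also have "\<dots> = (\<Prod>k\<leftarrow>k # ks. zero_mode_eigenvalue k S) * formal_eigenvalue \<alpha> S * exp (\<tau> * ?w S)"
        unfolding * by simp
      finally show "?c * (?p S * formal_eigenvalue ?\<beta> S * exp (\<tau> * ?w S)) =
          (\<Prod>k\<leftarrow>k # ks. zero_mode_eigenvalue k S) * formal_eigenvalue \<alpha> S * exp (\<tau> * ?w S)" .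
    qed
    finally show ?thesis .
  next
    case 4
    then have "foldr sigma_coeff (k # ks) V \<alpha> \<tau> = 0" by (simp add: sigma_coeff_def)
    also have "0 = (\<Sum>\<^sub>\<infinity>S\<in>?A. (\<Prod>k\<leftarrow>k # ks. zero_mode_eigenvalue k S) * formal_eigenvalue \<alpha> S * exp (\<tau> * ?w S))"
      using 4 by (intro infsum_0[symmetric]) (simp add: zero_mode_eigenvalue_low)
    finally show ?thesis .
  next
    case 5
    then have "foldr sigma_coeff (k # ks) V \<alpha> \<tau> = 0" by (simp add: sigma_coeff_def)
    also have "0 = (\<Sum>\<^sub>\<infinity>S\<in>?A. (\<Prod>k\<leftarrow>k # ks. zero_mode_eigenvalue k S) * formal_eigenvalue \<alpha> S * exp (\<tau> * ?w S))"
      using 5 by (intro infsum_0[symmetric]) (simp add: zero_mode_eigenvalue_low)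
    finally show ?thesis .
  qed
qed

theorem proposition3p1:
  fixes n :: nat and ks :: "int list" and \<tau> :: complex
  assumes "n \<ge> 1" and "length ks = n" and "Im \<tau> > 0"
  shows "eta \<tau> * at_zero (foldr sigma_coeff ks V) \<tau> = X_trace_coeff (replicate n 0) ks \<tau>
       \<and> X_trace_coeff (replicate n 0) ks \<tau> = o_trace_coeff ks \<tau>"
proof
  let ?O = "\<lambda>k. o_mode (Y_bracket_coeff psi_vec psi_star_vec k)"
  have "zip (replicate n (0 :: rat)) ks = map (Pair 0) ks"
    using assms(2) by (simp add: zip_replicate1)
  then show X: "X_trace_coeff (replicate n 0) ks \<tau> = o_trace_coeff ks \<tau>"
    by (simp add: X_trace_coeff_def o_trace_coeff_def foldr_map comp_def X_coeff_zero)
  have "diagonal_op (\<lambda>v. cscale (eta \<tau>) (foldr ?O ks (q_power \<tau> L0_bar v)))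
      (\<lambda>S. eta \<tau> * ((\<Prod>k\<leftarrow>ks. zero_mode_eigenvalue k S)
         * exp (2 * of_real pi * \<i> * \<tau> * zero_mode_eigenvalue 1 S)))"
    by (intro diagonal_op_cscale diagonal_op_foldr diagonal_op_o_mode diagonal_op_q_power diagonal_op_L0_bar)
  then have "o_trace_coeff ks \<tau> = eta \<tau> * (\<Sum>\<^sub>\<infinity>S\<in>{S. charge S = 0}.
      (\<Prod>k\<leftarrow>ks. zero_mode_eigenvalue k S) * exp (2 * of_real pi * \<i> * \<tau> * zero_mode_eigenvalue 1 S))"
    unfolding o_trace_coeff_def by (simp only: trace_F0_diagonal infsum_cmult_right')
  also have "\<dots> = eta \<tau> * at_zero (foldr sigma_coeff ks V) \<tau>"
    using foldr_sigma_coeff_V[OF assms(3), of 0 ks]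
    by (simp add: at_zero_def formal_eigenvalue_0 mult_ac)
  finally show "eta \<tau> * at_zero (foldr sigma_coeff ks V) \<tau> = X_trace_coeff (replicate n 0) ks \<tau>"
    by (simp add: X)
qed

end
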